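(* There is a strict 2-category of 2-term Leibniz infinity algebras, with objects the 2-term Leibniz infinity algebras, 1-morphisms the infinity morphisms between them, 2-morphisms the 2-term $\infty$-homotopies, vertical composition $\tau_1\circ_1\theta_1=\tau_1+\theta_1$ for $\theta_1:f\Rightarrow g$, $\tau_1:g\Rightarrow h$, horizontal composition $\tau_1\circ_0\theta_1=g_1'\theta_1+\tau_1f_1=f_1'\theta_1+\tau_1g_1$ for $\theta_1:f\Rightarrow g$ (with $f,g:V\to W$) and $\tau_1:f'\Rightarrow g'$ (with $f',g':W\to X$), and identity 2-morphism of an infinity morphism the zero map.
   Context: Work over a field of characteristic zero. **2-term Leibniz infinity algebra**: $V=V_0\oplus V_1$ with linear, bilinear, trilinear maps $l_1,l_2,l_3$ of degrees $-1,0,1$ such that for $w,x,y,z\in V_0$, $h,k\in V_1$: (a) $l_1l_2(x,h)=l_2(x,l_1h)$, $l_1l_2(h,x)=l_2(l_1h,x)$; (b) $l_2(l_1h,k)=l_2(h,l_1k)$; (c) $l_1l_3(x,y,z)=l_2(x,l_2(y,z))-l_2(y,l_2(x,z))-l_2(l_2(x,y),z)$; (d) $l_3(x,y,l_1h)=l_2(x,l_2(y,h))-l_2(y,l_2(x,h))-l_2(l_2(x,y),h)$, $l_3(x,l_1h,y)=l_2(x,l_2(h,y))-l_2(h,l_2(x,y))-l_2(l_2(x,h),y)$, $l_3(l_1h,x,y)=l_2(h,l_2(x,y))-l_2(x,l_2(h,y))-l_2(l_2(h,x),y)$; (e) $l_2(l_3(w,x,y),z)+l_2(w,l_3(x,y,z))-l_2(x,l_3(w,y,z))+l_2(y,l_3(w,x,z))-l_3(l_2(w,x),y,z)+l_3(w,l_2(x,y),z)-l_3(x,l_2(w,y),z)-l_3(w,x,l_2(y,z))+l_3(w,y,l_2(x,z))-l_3(x,y,l_2(w,z))=0$.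 **Infinity morphism** $f=(f_1,f_2):(V,l_\bullet)\to(W,m_\bullet)$: linear $f_1$, bilinear $f_2$ of degrees $0,1$ with, for $x,y,z\in V_0$, $h\in V_1$: $m_1f_1h=f_1l_1h$; $m_2(f_1x,f_1y)+m_1f_2(x,y)=f_1l_2(x,y)$; $m_2(f_1x,f_1h)=f_1l_2(x,h)-f_2(x,l_1h)$; $m_2(f_1h,f_1x)=f_1l_2(h,x)-f_2(l_1h,x)$; $m_3(f_1x,f_1y,f_1z)-m_2(f_2(x,y),f_1z)+m_2(f_1x,f_2(y,z))-m_2(f_1y,f_2(x,z))=f_1l_3(x,y,z)+f_2(l_2(x,y),z)-f_2(x,l_2(y,z))+f_2(y,l_2(x,z))$. Composition of infinity morphisms is composition of the corresponding morphisms of quasi-free differential graded Zinbiel coalgebras; for 2-term algebras, $(g\circ f)_1=g_1f_1$, $(g\circ f)_2(x,y)=g_2(f_1x,f_1y)+g_1f_2(x,y)$. **2-term $\infty$-homotopy** $\theta_1:f\Rightarrow g$ between infinity morphisms $f,g:V\to W$: a degree $1$ linear map $\theta_1:V\to W$ with, for $x,y\in V_0$, $h\in V_1$: $g_1x-f_1x=m_1\theta_1x$; $g_1h-f_1h=\theta_1l_1h$; $g_2(x,y)-f_2(x,y)=\theta_1l_2(x,y)-m_2(f_1x,\theta_1y)-m_2(\theta_1x,g_1y)$. *)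

theory Defs
  imports "HOL-Algebra.Module"
begin

definition char_zero_field :: "('k, 'r) ring_scheme \<Rightarrow> bool" where
  "char_zero_field R \<longleftrightarrow>
     field R \<and> (\<forall>n::nat. n > 0 \<longrightarrow> [n] \<cdot>\<^bsub>R\<^esub> \<one>\<^bsub>R\<^esub> \<noteq> \<zero>\<^bsub>R\<^esub>)"


section \<open>Strict 2-categories\<close>

text \<open>Hom-sets are families indexed by source and target, and compositions take these indices as
  arguments; so the same HOL value may represent morphisms in several hom-sets.\<close>

locale category =
  fixes Obj :: "'o set"
    and Hom :: "'o \<Rightarrow> 'o \<Rightarrow> 'm set"
    and comp :: "'o \<Rightarrow> 'o \<Rightarrow> 'o \<Rightarrow> 'm \<Rightarrow> 'm \<Rightarrow> 'm"
    and ident :: "'o \<Rightarrow> 'm"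
  assumes comp_closed:
      "\<lbrakk>a \<in> Obj; b \<in> Obj; c \<in> Obj; f \<in> Hom a b; g \<in> Hom b c\<rbrakk> \<Longrightarrow> comp a b c g f \<in> Hom a c"
    and ident_closed: "a \<in> Obj \<Longrightarrow> ident a \<in> Hom a a"
    and comp_assoc:
      "\<lbrakk>a \<in> Obj; b \<in> Obj; c \<in> Obj; d \<in> Obj; f \<in> Hom a b; g \<in> Hom b c; h \<in> Hom c d\<rbrakk>
       \<Longrightarrow> comp a b d (comp b c d h g) f = comp a c d h (comp a b c g f)"
    and comp_ident_left:
      "\<lbrakk>a \<in> Obj; b \<in> Obj; f \<in> Hom a b\<rbrakk> \<Longrightarrow> comp a b b (ident b) f = f"
    and comp_ident_right:
      "\<lbrakk>a \<in> Obj; b \<in> Obj; f \<in> Hom a b\<rbrakk> \<Longrightarrow> comp a a b f (ident a) = f"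

text \<open>\<open>Hom2 a b f g\<close> is the set of 2-morphisms from \<open>f\<close> to \<open>g\<close>, where \<open>f\<close> and \<open>g\<close> are in \<open>Hom a b\<close>.
  For \<open>\<theta>\<close> in \<open>Hom2 a b f g\<close> and \<open>\<tau>\<close> in \<open>Hom2 b c f' g'\<close>, the horizontal composite, from
  \<open>f' \<circ> f\<close> to \<open>g' \<circ> g\<close>, is \<open>hcomp a b c f g f' g' \<tau> \<theta>\<close>.\<close>

locale strict_2_category =
  one: category Obj Hom comp ident
  for Obj :: "'o set"
    and Hom :: "'o \<Rightarrow> 'o \<Rightarrow> 'm set"
    and comp :: "'o \<Rightarrow> 'o \<Rightarrow> 'o \<Rightarrow> 'm \<Rightarrow> 'm \<Rightarrow> 'm"
    and ident :: "'o \<Rightarrow> 'm" +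
  fixes Hom2 :: "'o \<Rightarrow> 'o \<Rightarrow> 'm \<Rightarrow> 'm \<Rightarrow> 'c set"
    and vcomp :: "'o \<Rightarrow> 'o \<Rightarrow> 'm \<Rightarrow> 'm \<Rightarrow> 'm \<Rightarrow> 'c \<Rightarrow> 'c \<Rightarrow> 'c"
    and hcomp :: "'o \<Rightarrow> 'o \<Rightarrow> 'o \<Rightarrow> 'm \<Rightarrow> 'm \<Rightarrow> 'm \<Rightarrow> 'm \<Rightarrow> 'c \<Rightarrow> 'c \<Rightarrow> 'c"
    and ident2 :: "'o \<Rightarrow> 'o \<Rightarrow> 'm \<Rightarrow> 'c"
  assumes vertical_category:
      "\<lbrakk>a \<in> Obj; b \<in> Obj\<rbrakk> \<Longrightarrow> category (Hom a b) (Hom2 a b) (vcomp a b) (ident2 a b)"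
    and hcomp_closed:
      "\<lbrakk>a \<in> Obj; b \<in> Obj; c \<in> Obj; f \<in> Hom a b; g \<in> Hom a b; f' \<in> Hom b c; g' \<in> Hom b c;
        \<theta> \<in> Hom2 a b f g; \<tau> \<in> Hom2 b c f' g'\<rbrakk>
       \<Longrightarrow> hcomp a b c f g f' g' \<tau> \<theta> \<in> Hom2 a c (comp a b c f' f) (comp a b c g' g)"
    and hcomp_ident2:
      "\<lbrakk>a \<in> Obj; b \<in> Obj; c \<in> Obj; f \<in> Hom a b; f' \<in> Hom b c\<rbrakk>
       \<Longrightarrow> hcomp a b c f f f' f' (ident2 b c f') (ident2 a b f) = ident2 a c (comp a b c f' f)"
    and interchange:
      "\<lbrakk>a \<in> Obj; b \<in> Obj; c \<in> Obj;
        f \<in> Hom a b; g \<in> Hom a b; h \<in> Hom a b; f' \<in> Hom b c; g' \<in> Hom b c; h' \<in> Hom b c;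
        \<theta> \<in> Hom2 a b f g; \<theta>' \<in> Hom2 a b g h; \<tau> \<in> Hom2 b c f' g'; \<tau>' \<in> Hom2 b c g' h'\<rbrakk>
       \<Longrightarrow> hcomp a b c f h f' h' (vcomp b c f' g' h' \<tau>' \<tau>) (vcomp a b f g h \<theta>' \<theta>)
         = vcomp a c (comp a b c f' f) (comp a b c g' g) (comp a b c h' h)
             (hcomp a b c g h g' h' \<tau>' \<theta>') (hcomp a b c f g f' g' \<tau> \<theta>)"
    and hcomp_assoc:
      "\<lbrakk>a \<in> Obj; b \<in> Obj; c \<in> Obj; d \<in> Obj;
        f \<in> Hom a b; g \<in> Hom a b; f' \<in> Hom b c; g' \<in> Hom b c; f'' \<in> Hom c d; g'' \<in> Hom c d;
        \<theta> \<in> Hom2 a b f g; \<tau> \<in> Hom2 b c f' g'; \<sigma> \<in> Hom2 c d f'' g''\<rbrakk>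
       \<Longrightarrow> hcomp a b d f g (comp b c d f'' f') (comp b c d g'' g')
             (hcomp b c d f' g' f'' g'' \<sigma> \<tau>) \<theta>
         = hcomp a c d (comp a b c f' f) (comp a b c g' g) f'' g''
             \<sigma> (hcomp a b c f g f' g' \<tau> \<theta>)"
    and hcomp_ident_left:
      "\<lbrakk>a \<in> Obj; b \<in> Obj; f \<in> Hom a b; g \<in> Hom a b; \<theta> \<in> Hom2 a b f g\<rbrakk>
       \<Longrightarrow> hcomp a b b f g (ident b) (ident b) (ident2 b b (ident b)) \<theta> = \<theta>"
    and hcomp_ident_right:
      "\<lbrakk>a \<in> Obj; b \<in> Obj; f \<in> Hom a b; g \<in> Hom a b; \<theta> \<in> Hom2 a b f g\<rbrakk>
       \<Longrightarrow> hcomp a a b (ident a) (ident a) f g \<theta> (ident2 a a (ident a)) = \<theta>"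


section \<open>Multilinear maps between modules\<close>

text \<open>Maps are extensional, i.e. \<open>undefined\<close> off the carrier, so that HOL equality is equality of maps.
  Multilinear maps are curried.\<close>

definition lin_maps ::
    "('k, 'r) ring_scheme \<Rightarrow> ('k, 'a) module \<Rightarrow> ('k, 'b) module \<Rightarrow> ('a \<Rightarrow> 'b) set" where
  "lin_maps R M N =
     {f \<in> carrier M \<rightarrow>\<^sub>E carrier N.
        (\<forall>x\<in>carrier M. \<forall>y\<in>carrier M. f (x \<oplus>\<^bsub>M\<^esub> y) = f x \<oplus>\<^bsub>N\<^esub> f y) \<and>
        (\<forall>c\<in>carrier R. \<forall>x\<in>carrier M. f (c \<odot>\<^bsub>M\<^esub> x) = c \<odot>\<^bsub>N\<^esub> f x)}"

definition bilin_maps ::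
    "('k, 'r) ring_scheme \<Rightarrow> ('k, 'a) module \<Rightarrow> ('k, 'b) module \<Rightarrow> ('k, 'c) module
      \<Rightarrow> ('a \<Rightarrow> 'b \<Rightarrow> 'c) set" where
  "bilin_maps R M N P =
     {b \<in> carrier M \<rightarrow>\<^sub>E lin_maps R N P.
        \<forall>y\<in>carrier N. (\<lambda>x\<in>carrier M. b x y) \<in> lin_maps R M P}"

definition trilin_maps ::
    "('k, 'r) ring_scheme \<Rightarrow> ('k, 'a) module \<Rightarrow> ('k, 'b) module \<Rightarrow> ('k, 'c) module
      \<Rightarrow> ('k, 'd) module \<Rightarrow> ('a \<Rightarrow> 'b \<Rightarrow> 'c \<Rightarrow> 'd) set" where
  "trilin_maps R M N P Q =
     {t \<in> carrier M \<rightarrow>\<^sub>E bilin_maps R N P Q.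
        \<forall>y\<in>carrier N. \<forall>z\<in>carrier P. (\<lambda>x\<in>carrier M. t x y z) \<in> lin_maps R M Q}"


section \<open>2-term Leibniz infinity algebras\<close>

text \<open>The graded space \<open>V = V\<^sub>0 \<oplus> V\<^sub>1\<close> is the pair of its homogeneous parts \<open>deg0\<close>, \<open>deg1\<close>, and a
  homogeneous multilinear map is given by its components; e.g. \<open>l2_01\<close> is the component
  \<open>V\<^sub>0 \<times> V\<^sub>1 \<rightarrow> V\<^sub>1\<close> of \<open>l\<^sub>2\<close>. Components not listed, such as \<open>V\<^sub>1 \<times> V\<^sub>1 \<rightarrow> V\<^sub>2\<close>, have target zero for
  degree reasons.\<close>

record ('k, 'a, 'b) leibniz2 =
  deg0 :: "('k, 'a) module"
  deg1 :: "('k, 'b) module"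
  l1 :: "'b \<Rightarrow> 'a"
  l2_00 :: "'a \<Rightarrow> 'a \<Rightarrow> 'a"
  l2_01 :: "'a \<Rightarrow> 'b \<Rightarrow> 'b"
  l2_10 :: "'b \<Rightarrow> 'a \<Rightarrow> 'b"
  l3 :: "'a \<Rightarrow> 'a \<Rightarrow> 'a \<Rightarrow> 'b"

definition leibniz2_algebras ::
    "('k, 'r) ring_scheme \<Rightarrow> ('k, 'a, 'b) leibniz2 set" where
  "leibniz2_algebras R = {V.
     module R (deg0 V) \<and> module R (deg1 V) \<and>
     l1 V \<in> lin_maps R (deg1 V) (deg0 V) \<and>
     l2_00 V \<in> bilin_maps R (deg0 V) (deg0 V) (deg0 V) \<and>
     l2_01 V \<in> bilin_maps R (deg0 V) (deg1 V) (deg1 V) \<and>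
     l2_10 V \<in> bilin_maps R (deg1 V) (deg0 V) (deg1 V) \<and>
     l3 V \<in> trilin_maps R (deg0 V) (deg0 V) (deg0 V) (deg1 V) \<and>
     (\<forall>x\<in>carrier (deg0 V). \<forall>h\<in>carrier (deg1 V).
        l1 V (l2_01 V x h) = l2_00 V x (l1 V h) \<and>
        l1 V (l2_10 V h x) = l2_00 V (l1 V h) x) \<and>
     (\<forall>h\<in>carrier (deg1 V). \<forall>k\<in>carrier (deg1 V).
        l2_01 V (l1 V h) k = l2_10 V h (l1 V k)) \<and>
     (\<forall>x\<in>carrier (deg0 V). \<forall>y\<in>carrier (deg0 V). \<forall>z\<in>carrier (deg0 V).
        l1 V (l3 V x y z) =
          l2_00 V x (l2_00 V y z)
            \<ominus>\<^bsub>deg0 V\<^esub> l2_00 V y (l2_00 V x z)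
            \<ominus>\<^bsub>deg0 V\<^esub> l2_00 V (l2_00 V x y) z) \<and>
     (\<forall>x\<in>carrier (deg0 V). \<forall>y\<in>carrier (deg0 V). \<forall>h\<in>carrier (deg1 V).
        l3 V x y (l1 V h) =
          l2_01 V x (l2_01 V y h)
            \<ominus>\<^bsub>deg1 V\<^esub> l2_01 V y (l2_01 V x h)
            \<ominus>\<^bsub>deg1 V\<^esub> l2_01 V (l2_00 V x y) h \<and>
        l3 V x (l1 V h) y =
          l2_01 V x (l2_10 V h y)
            \<ominus>\<^bsub>deg1 V\<^esub> l2_10 V h (l2_00 V x y)
            \<ominus>\<^bsub>deg1 V\<^esub> l2_10 V (l2_01 V x h) y \<and>
        l3 V (l1 V h) x y =
          l2_10 V h (l2_00 V x y)
            \<ominus>\<^bsub>deg1 V\<^esub> l2_01 V x (l2_10 V h y)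
            \<ominus>\<^bsub>deg1 V\<^esub> l2_10 V (l2_10 V h x) y) \<and>
     (\<forall>w\<in>carrier (deg0 V). \<forall>x\<in>carrier (deg0 V). \<forall>y\<in>carrier (deg0 V). \<forall>z\<in>carrier (deg0 V).
        l2_10 V (l3 V w x y) z
          \<oplus>\<^bsub>deg1 V\<^esub> l2_01 V w (l3 V x y z)
          \<ominus>\<^bsub>deg1 V\<^esub> l2_01 V x (l3 V w y z)
          \<oplus>\<^bsub>deg1 V\<^esub> l2_01 V y (l3 V w x z)
          \<ominus>\<^bsub>deg1 V\<^esub> l3 V (l2_00 V w x) y z
          \<oplus>\<^bsub>deg1 V\<^esub> l3 V w (l2_00 V x y) z
          \<ominus>\<^bsub>deg1 V\<^esub> l3 V x (l2_00 V w y) z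
          \<ominus>\<^bsub>deg1 V\<^esub> l3 V w x (l2_00 V y z)
          \<oplus>\<^bsub>deg1 V\<^esub> l3 V w y (l2_00 V x z)
          \<ominus>\<^bsub>deg1 V\<^esub> l3 V x y (l2_00 V w z) = \<zero>\<^bsub>deg1 V\<^esub>)}"


section \<open>Infinity morphisms\<close>

text \<open>\<open>f1_0\<close> and \<open>f1_1\<close> are the components of \<open>f\<^sub>1\<close> in degrees 0 and 1; \<open>f2\<close> maps
  \<open>V\<^sub>0 \<times> V\<^sub>0\<close> to \<open>W\<^sub>1\<close>.\<close>

record ('a, 'b) inf_morphism =
  f1_0 :: "'a \<Rightarrow> 'a"
  f1_1 :: "'b \<Rightarrow> 'b"
  f2 :: "'a \<Rightarrow> 'a \<Rightarrow> 'b"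

definition inf_morphisms ::
    "('k, 'r) ring_scheme \<Rightarrow> ('k, 'a, 'b) leibniz2 \<Rightarrow> ('k, 'a, 'b) leibniz2
      \<Rightarrow> ('a, 'b) inf_morphism set" where
  "inf_morphisms R V W = {f.
     f1_0 f \<in> lin_maps R (deg0 V) (deg0 W) \<and>
     f1_1 f \<in> lin_maps R (deg1 V) (deg1 W) \<and>
     f2 f \<in> bilin_maps R (deg0 V) (deg0 V) (deg1 W) \<and>
     (\<forall>h\<in>carrier (deg1 V). l1 W (f1_1 f h) = f1_0 f (l1 V h)) \<and>
     (\<forall>x\<in>carrier (deg0 V). \<forall>y\<in>carrier (deg0 V).
        l2_00 W (f1_0 f x) (f1_0 f y) \<oplus>\<^bsub>deg0 W\<^esub> l1 W (f2 f x y) = f1_0 f (l2_00 V x y)) \<and>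
     (\<forall>x\<in>carrier (deg0 V). \<forall>h\<in>carrier (deg1 V).
        l2_01 W (f1_0 f x) (f1_1 f h) = f1_1 f (l2_01 V x h) \<ominus>\<^bsub>deg1 W\<^esub> f2 f x (l1 V h) \<and>
        l2_10 W (f1_1 f h) (f1_0 f x) = f1_1 f (l2_10 V h x) \<ominus>\<^bsub>deg1 W\<^esub> f2 f (l1 V h) x) \<and>
     (\<forall>x\<in>carrier (deg0 V). \<forall>y\<in>carrier (deg0 V). \<forall>z\<in>carrier (deg0 V).
        l3 W (f1_0 f x) (f1_0 f y) (f1_0 f z)
          \<ominus>\<^bsub>deg1 W\<^esub> l2_10 W (f2 f x y) (f1_0 f z)
          \<oplus>\<^bsub>deg1 W\<^esub> l2_01 W (f1_0 f x) (f2 f y z)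
          \<ominus>\<^bsub>deg1 W\<^esub> l2_01 W (f1_0 f y) (f2 f x z) =
        f1_1 f (l3 V x y z)
          \<oplus>\<^bsub>deg1 W\<^esub> f2 f (l2_00 V x y) z
          \<ominus>\<^bsub>deg1 W\<^esub> f2 f x (l2_00 V y z)
          \<oplus>\<^bsub>deg1 W\<^esub> f2 f y (l2_00 V x z))}"

definition inf_comp ::
    "('k, 'a, 'b) leibniz2 \<Rightarrow> ('k, 'a, 'b) leibniz2 \<Rightarrow> ('k, 'a, 'b) leibniz2
      \<Rightarrow> ('a, 'b) inf_morphism \<Rightarrow> ('a, 'b) inf_morphism \<Rightarrow> ('a, 'b) inf_morphism" where
  "inf_comp V W X g f =
     \<lparr>f1_0 = (\<lambda>x\<in>carrier (deg0 V). f1_0 g (f1_0 f x)),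
      f1_1 = (\<lambda>h\<in>carrier (deg1 V). f1_1 g (f1_1 f h)),
      f2 = (\<lambda>x\<in>carrier (deg0 V). \<lambda>y\<in>carrier (deg0 V).
              f2 g (f1_0 f x) (f1_0 f y) \<oplus>\<^bsub>deg1 X\<^esub> f1_1 g (f2 f x y))\<rparr>"

definition inf_ident :: "('k, 'a, 'b) leibniz2 \<Rightarrow> ('a, 'b) inf_morphism" where
  "inf_ident V =
     \<lparr>f1_0 = (\<lambda>x\<in>carrier (deg0 V). x),
      f1_1 = (\<lambda>h\<in>carrier (deg1 V). h),
      f2 = (\<lambda>x\<in>carrier (deg0 V). \<lambda>y\<in>carrier (deg0 V). \<zero>\<^bsub>deg1 V\<^esub>)\<rparr>"


section \<open>2-term infinity homotopies\<close>

text \<open>A degree 1 map from \<open>V\<close> to \<open>W\<close> is its component \<open>V\<^sub>0 \<rightarrow> W\<^sub>1\<close>.\<close>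

definition homotopies ::
    "('k, 'r) ring_scheme \<Rightarrow> ('k, 'a, 'b) leibniz2 \<Rightarrow> ('k, 'a, 'b) leibniz2
      \<Rightarrow> ('a, 'b) inf_morphism \<Rightarrow> ('a, 'b) inf_morphism \<Rightarrow> ('a \<Rightarrow> 'b) set" where
  "homotopies R V W f g = {\<theta> \<in> lin_maps R (deg0 V) (deg1 W).
     (\<forall>x\<in>carrier (deg0 V). f1_0 g x \<ominus>\<^bsub>deg0 W\<^esub> f1_0 f x = l1 W (\<theta> x)) \<and>
     (\<forall>h\<in>carrier (deg1 V). f1_1 g h \<ominus>\<^bsub>deg1 W\<^esub> f1_1 f h = \<theta> (l1 V h)) \<and>
     (\<forall>x\<in>carrier (deg0 V). \<forall>y\<in>carrier (deg0 V).
        f2 g x y \<ominus>\<^bsub>deg1 W\<^esub> f2 f x y =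
          \<theta> (l2_00 V x y)
            \<ominus>\<^bsub>deg1 W\<^esub> l2_01 W (f1_0 f x) (\<theta> y)
            \<ominus>\<^bsub>deg1 W\<^esub> l2_10 W (\<theta> x) (f1_0 g y))}"

definition homotopy_vcomp ::
    "('k, 'a, 'b) leibniz2 \<Rightarrow> ('k, 'a, 'b) leibniz2
      \<Rightarrow> ('a \<Rightarrow> 'b) \<Rightarrow> ('a \<Rightarrow> 'b) \<Rightarrow> 'a \<Rightarrow> 'b" where
  "homotopy_vcomp V W \<tau> \<theta> = (\<lambda>x\<in>carrier (deg0 V). \<tau> x \<oplus>\<^bsub>deg1 W\<^esub> \<theta> x)"

text \<open>\<open>homotopy_hcomp V X p q \<tau> \<theta>\<close> is \<open>p\<^sub>1 \<theta> + \<tau> q\<^sub>1\<close>.\<close>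

definition homotopy_hcomp ::
    "('k, 'a, 'b) leibniz2 \<Rightarrow> ('k, 'a, 'b) leibniz2
      \<Rightarrow> ('a, 'b) inf_morphism \<Rightarrow> ('a, 'b) inf_morphism
      \<Rightarrow> ('a \<Rightarrow> 'b) \<Rightarrow> ('a \<Rightarrow> 'b) \<Rightarrow> 'a \<Rightarrow> 'b" where
  "homotopy_hcomp V X p q \<tau> \<theta> =
     (\<lambda>x\<in>carrier (deg0 V). f1_1 p (\<theta> x) \<oplus>\<^bsub>deg1 X\<^esub> \<tau> (f1_0 q x))"

definition homotopy_zero ::
    "('k, 'a, 'b) leibniz2 \<Rightarrow> ('k, 'a, 'b) leibniz2 \<Rightarrow> 'a \<Rightarrow> 'b" where
  "homotopy_zero V W = (\<lambda>x\<in>carrier (deg0 V). \<zero>\<^bsub>deg1 W\<^esub>)"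

end

theory Submission
  imports Defs
begin

text \<open>
  The compositions are given by explicit formulas, so the unit and associativity laws are
  rearrangements of sums. Only closure of the compositions and the interchange law have content.

  A composite \<open>gf\<close> of infinity morphisms satisfies the coherence law for \<open>l\<^sub>3\<close> because that law is the
  sum of two others: the law of \<open>g\<close> at the images under \<open>f\<^sub>1\<close>, and the image under \<open>g\<^sub>1\<close> of the law of
  \<open>f\<close>. The terms \<open>g\<^sub>1m\<^sub>2\<close> of the second are corrected by \<open>g\<^sub>2\<close> of boundaries \<open>m\<^sub>1f\<^sub>2\<close>, which are just what
  turns \<open>m\<^sub>2(f\<^sub>1x, f\<^sub>1y)\<close> into \<open>f\<^sub>1l\<^sub>2(x, y)\<close> in the first (\<open>inf_comp_l3\<close>).

  For a vertical composite of \<open>\<theta>: f \<Rightarrow> g\<close> and \<open>\<tau>: g \<Rightarrow> h\<close>, adding the equations for \<open>f\<^sub>2\<close> leaves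
  \<open>m\<^sub>2(g\<^sub>1x, \<tau>y) + m\<^sub>2(\<theta>x, g\<^sub>1y)\<close> where \<open>m\<^sub>2(f\<^sub>1x, \<tau>y) + m\<^sub>2(\<theta>x, h\<^sub>1y)\<close> is wanted. The difference is
  \<open>m\<^sub>2(m\<^sub>1\<theta>x, \<tau>y) - m\<^sub>2(\<theta>x, m\<^sub>1\<tau>y)\<close>, which vanishes by the compatibility of \<open>m\<^sub>1\<close> and \<open>m\<^sub>2\<close> on
  \<open>W\<^sub>1 \<times> W\<^sub>1\<close> (\<open>homotopy_vcomp_in_homotopies\<close>).

  Horizontal composition reduces to vertical composition by whiskering: \<open>\<tau>f\<^sub>1\<close> is a homotopy from
  \<open>f'f\<close> to \<open>g'f\<close>, and \<open>g'\<^sub>1\<theta>\<close> is one from \<open>g'f\<close> to \<open>g'g\<close>. Going through \<open>f'g\<close> instead gives the same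
  map, since \<open>(g'\<^sub>1 - f'\<^sub>1)\<theta> = \<tau>m\<^sub>1\<theta> = \<tau>(g\<^sub>1 - f\<^sub>1)\<close> (\<open>whisker_exchange\<close>). This is the equality of the two
  formulas for the horizontal composite, and it also yields the interchange law.
\<close>

section \<open>Equations without subtraction\<close>

text \<open>With the subtracted terms moved to the other side, every identity below is one between sums,
  and such sums can be compared by associativity and commutativity alone. As rewrite rules, the
  following lemmas do this move.\<close>

context abelian_group
begin

lemma minus_eq_iff:
  "\<lbrakk>x \<in> carrier G; y \<in> carrier G; z \<in> carrier G\<rbrakk> \<Longrightarrow> x \<ominus> y = z \<longleftrightarrow> x = z \<oplus> y"
  by (metis a_assoc a_inv_closed l_neg minus_closed minus_eq r_neg r_zero)

lemma eq_minus_iff: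
  "\<lbrakk>x \<in> carrier G; y \<in> carrier G; z \<in> carrier G\<rbrakk> \<Longrightarrow> z = x \<ominus> y \<longleftrightarrow> z \<oplus> y = x"
  using minus_eq_iff[of x y z] by auto

lemma minus_add_right_commute:
  "\<lbrakk>x \<in> carrier G; y \<in> carrier G; z \<in> carrier G\<rbrakk> \<Longrightarrow> (x \<ominus> y) \<oplus> z = (x \<oplus> z) \<ominus> y"
  by (simp add: minus_eq a_ac)

lemma add_minus_assoc:
  "\<lbrakk>x \<in> carrier G; y \<in> carrier G; z \<in> carrier G\<rbrakk> \<Longrightarrow> z \<oplus> (x \<ominus> y) = (z \<oplus> x) \<ominus> y"
  by (simp add: minus_eq a_ac)

lemmas subtraction_free =
  minus_eq_iff eq_minus_iff minus_add_right_commute add_minus_assoc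

end


section \<open>Linear and bilinear maps\<close>

lemma lin_mapsD:
  assumes "f \<in> lin_maps R M N"
  shows "x \<in> carrier M \<Longrightarrow> f x \<in> carrier N"
    and "x \<in> carrier M \<Longrightarrow> y \<in> carrier M \<Longrightarrow> f (x \<oplus>\<^bsub>M\<^esub> y) = f x \<oplus>\<^bsub>N\<^esub> f y"
    and "c \<in> carrier R \<Longrightarrow> x \<in> carrier M \<Longrightarrow> f (c \<odot>\<^bsub>M\<^esub> x) = c \<odot>\<^bsub>N\<^esub> f x"
  using assms by (auto simp: lin_maps_def)

lemma lin_maps_eqI:
  assumes "f \<in> lin_maps R M N" "g \<in> lin_maps R M N" "\<And>x. x \<in> carrier M \<Longrightarrow> f x = g x"
  shows "f = g"
  using assms by (auto simp: lin_maps_def intro: PiE_ext)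

lemma lin_maps_zero:
  assumes "f \<in> lin_maps R M N" "module R M" "module R N"
  shows "f \<zero>\<^bsub>M\<^esub> = \<zero>\<^bsub>N\<^esub>"
proof -
  interpret M: module R M by fact
  interpret N: module R N by fact
  have "f \<zero>\<^bsub>M\<^esub> \<oplus>\<^bsub>N\<^esub> f \<zero>\<^bsub>M\<^esub> = f \<zero>\<^bsub>M\<^esub>"
    using lin_mapsD(2)[OF assms(1), of "\<zero>\<^bsub>M\<^esub>" "\<zero>\<^bsub>M\<^esub>"] by simp
  then show ?thesis
    using lin_mapsD(1)[OF assms(1), of "\<zero>\<^bsub>M\<^esub>"] by simp
qed

lemma restrict_in_lin_maps:
  assumes "module R M"
    and "\<And>x. x \<in> carrier M \<Longrightarrow> f x \<in> carrier N"
    and "\<And>x y. x \<in> carrier M \<Longrightarrow> y \<in> carrier M \<Longrightarrow> f (x \<oplus>\<^bsub>M\<^esub> y) = f x \<oplus>\<^bsub>N\<^esub> f y"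
    and "\<And>c x. c \<in> carrier R \<Longrightarrow> x \<in> carrier M \<Longrightarrow> f (c \<odot>\<^bsub>M\<^esub> x) = c \<odot>\<^bsub>N\<^esub> f x"
  shows "(\<lambda>x\<in>carrier M. f x) \<in> lin_maps R M N"
proof -
  interpret M: module R M by fact
  show ?thesis using assms by (auto simp: lin_maps_def)
qed

lemma lin_maps_compose:
  assumes "f \<in> lin_maps R M N" "g \<in> lin_maps R N P" "module R M"
  shows "(\<lambda>x\<in>carrier M. g (f x)) \<in> lin_maps R M P"
  by (rule restrict_in_lin_maps) (use assms in \<open>auto simp: lin_mapsD\<close>)

lemma lin_maps_add:
  assumes "f \<in> lin_maps R M N" "g \<in> lin_maps R M N" "module R M" "module R N"
  shows "(\<lambda>x\<in>carrier M. f x \<oplus>\<^bsub>N\<^esub> g x) \<in> lin_maps R M N"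
proof -
  interpret N: module R N by fact
  show ?thesis
    by (rule restrict_in_lin_maps)
      (use assms in \<open>auto simp: lin_mapsD N.M.a_ac N.smult_r_distr\<close>)
qed

lemma bilin_mapsD:
  assumes "b \<in> bilin_maps R M N P"
  shows "x \<in> carrier M \<Longrightarrow> b x \<in> lin_maps R N P"
    and "y \<in> carrier N \<Longrightarrow> (\<lambda>x\<in>carrier M. b x y) \<in> lin_maps R M P"
  using assms by (auto simp: bilin_maps_def)

lemma bilin_maps_closed:
  assumes "b \<in> bilin_maps R M N P" "x \<in> carrier M" "y \<in> carrier N"
  shows "b x y \<in> carrier P"
  using assms by (blast dest: bilin_mapsD lin_mapsD)

lemma bilin_maps_right:
  assumes "b \<in> bilin_maps R M N P" "x \<in> carrier M"
  shows "y \<in> carrier N \<Longrightarrow> z \<in> carrier N \<Longrightarrow> b x (y \<oplus>\<^bsub>N\<^esub> z) = b x y \<oplus>\<^bsub>P\<^esub> b x z"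
    and "c \<in> carrier R \<Longrightarrow> y \<in> carrier N \<Longrightarrow> b x (c \<odot>\<^bsub>N\<^esub> y) = c \<odot>\<^bsub>P\<^esub> b x y"
    and "module R N \<Longrightarrow> module R P \<Longrightarrow> b x \<zero>\<^bsub>N\<^esub> = \<zero>\<^bsub>P\<^esub>"
  using bilin_mapsD(1)[OF assms] by (auto simp: lin_mapsD intro: lin_maps_zero)

lemma bilin_maps_left:
  assumes "b \<in> bilin_maps R M N P" "y \<in> carrier N" "module R M"
  shows "x \<in> carrier M \<Longrightarrow> z \<in> carrier M \<Longrightarrow> b (x \<oplus>\<^bsub>M\<^esub> z) y = b x y \<oplus>\<^bsub>P\<^esub> b z y"
    and "c \<in> carrier R \<Longrightarrow> x \<in> carrier M \<Longrightarrow> b (c \<odot>\<^bsub>M\<^esub> x) y = c \<odot>\<^bsub>P\<^esub> b x y"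
    and "module R P \<Longrightarrow> b \<zero>\<^bsub>M\<^esub> y = \<zero>\<^bsub>P\<^esub>"
proof -
  interpret M: module R M by fact
  note lin = bilin_mapsD(2)[OF assms(1,2)]
  show "x \<in> carrier M \<Longrightarrow> z \<in> carrier M \<Longrightarrow> b (x \<oplus>\<^bsub>M\<^esub> z) y = b x y \<oplus>\<^bsub>P\<^esub> b z y"
    using lin_mapsD(2)[OF lin, of x z] by simp
  show "c \<in> carrier R \<Longrightarrow> x \<in> carrier M \<Longrightarrow> b (c \<odot>\<^bsub>M\<^esub> x) y = c \<odot>\<^bsub>P\<^esub> b x y"
    using lin_mapsD(3)[OF lin, of c x] by simp
  show "module R P \<Longrightarrow> b \<zero>\<^bsub>M\<^esub> y = \<zero>\<^bsub>P\<^esub>"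
    using lin_maps_zero[OF lin assms(3)] by simp
qed

lemma restrict_in_bilin_maps:
  assumes M: "module R M" and N: "module R N"
    and "\<And>x y. x \<in> carrier M \<Longrightarrow> y \<in> carrier N \<Longrightarrow> b x y \<in> carrier P"
    and "\<And>x y z. x \<in> carrier M \<Longrightarrow> y \<in> carrier N \<Longrightarrow> z \<in> carrier N \<Longrightarrow>
           b x (y \<oplus>\<^bsub>N\<^esub> z) = b x y \<oplus>\<^bsub>P\<^esub> b x z"
    and "\<And>c x y. c \<in> carrier R \<Longrightarrow> x \<in> carrier M \<Longrightarrow> y \<in> carrier N \<Longrightarrow>
           b x (c \<odot>\<^bsub>N\<^esub> y) = c \<odot>\<^bsub>P\<^esub> b x y"
    and "\<And>x y z. x \<in> carrier M \<Longrightarrow> y \<in> carrier N \<Longrightarrow> z \<in> carrier M \<Longrightarrow>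
           b (x \<oplus>\<^bsub>M\<^esub> z) y = b x y \<oplus>\<^bsub>P\<^esub> b z y"
    and "\<And>c x y. c \<in> carrier R \<Longrightarrow> x \<in> carrier M \<Longrightarrow> y \<in> carrier N \<Longrightarrow>
           b (c \<odot>\<^bsub>M\<^esub> x) y = c \<odot>\<^bsub>P\<^esub> b x y"
  shows "(\<lambda>x\<in>carrier M. \<lambda>y\<in>carrier N. b x y) \<in> bilin_maps R M N P"
proof -
  have "(\<lambda>y\<in>carrier N. b x y) \<in> lin_maps R N P" if "x \<in> carrier M" for x
    by (rule restrict_in_lin_maps) (use assms that in auto)
  moreover have "(\<lambda>x\<in>carrier M. (\<lambda>x\<in>carrier M. \<lambda>y\<in>carrier N. b x y) x y) \<in> lin_maps R M P"
    if y: "y \<in> carrier N" for y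
  proof -
    have "(\<lambda>x\<in>carrier M. b x y) \<in> lin_maps R M P"
      by (rule restrict_in_lin_maps) (use assms y in auto)
    moreover have "(\<lambda>x\<in>carrier M. (\<lambda>x\<in>carrier M. \<lambda>y\<in>carrier N. b x y) x y)
        = (\<lambda>x\<in>carrier M. b x y)"
      using y by (auto simp: restrict_def)
    ultimately show ?thesis by simp
  qed
  ultimately show ?thesis by (auto simp: bilin_maps_def)
qed

lemma bilin_maps_eqI:
  assumes b: "b \<in> bilin_maps R M N P" and b': "b' \<in> bilin_maps R M N P"
    and eq: "\<And>x y. x \<in> carrier M \<Longrightarrow> y \<in> carrier N \<Longrightarrow> b x y = b' x y"
  shows "b = b'"
proof (rule PiE_ext)
  show "b \<in> carrier M \<rightarrow>\<^sub>E lin_maps R N P" "b' \<in> carrier M \<rightarrow>\<^sub>E lin_maps R N P"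
    using b b' by (auto simp: bilin_maps_def)
  show "b x = b' x" if "x \<in> carrier M" for x
    by (rule lin_maps_eqI) (use bilin_mapsD(1)[OF b that] bilin_mapsD(1)[OF b' that] eq that in auto)
qed


section \<open>Subtraction-free laws of algebras, morphisms and homotopies\<close>

locale leibniz2_algebra =
  fixes R :: "('k, 'r) ring_scheme" and V :: "('k, 'a, 'b) leibniz2"
  assumes algebra: "V \<in> leibniz2_algebras R"
begin

sublocale deg0: module R "deg0 V"
  using algebra by (simp add: leibniz2_algebras_def)

sublocale deg1: module R "deg1 V"
  using algebra by (simp add: leibniz2_algebras_def)

lemma structure_maps:
  "l1 V \<in> lin_maps R (deg1 V) (deg0 V)"
  "l2_00 V \<in> bilin_maps R (deg0 V) (deg0 V) (deg0 V)"
  "l2_01 V \<in> bilin_maps R (deg0 V) (deg1 V) (deg1 V)"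
  "l2_10 V \<in> bilin_maps R (deg1 V) (deg0 V) (deg1 V)"
  "l3 V \<in> trilin_maps R (deg0 V) (deg0 V) (deg0 V) (deg1 V)"
  using algebra by (simp_all add: leibniz2_algebras_def)

lemma l3_closed [simp]:
  "\<lbrakk>x \<in> carrier (deg0 V); y \<in> carrier (deg0 V); z \<in> carrier (deg0 V)\<rbrakk>
   \<Longrightarrow> l3 V x y z \<in> carrier (deg1 V)"
  using structure_maps(5) by (auto simp: trilin_maps_def intro: bilin_maps_closed)

lemmas closed [simp] =
  lin_mapsD(1)[OF structure_maps(1)]
  bilin_maps_closed[OF structure_maps(2)]
  bilin_maps_closed[OF structure_maps(3)]
  bilin_maps_closed[OF structure_maps(4)]

lemmas l1_add [simp] = lin_mapsD(2)[OF structure_maps(1)]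

lemmas l1_zero [simp] =
  lin_maps_zero[OF structure_maps(1) deg1.module_axioms deg0.module_axioms]

lemmas l2_add [simp] =
  bilin_maps_right(1)[OF structure_maps(3)]
  bilin_maps_right(1)[OF structure_maps(4)]
  bilin_maps_left(1)[OF structure_maps(3) _ deg0.module_axioms]
  bilin_maps_left(1)[OF structure_maps(4) _ deg1.module_axioms]

lemmas l2_zero [simp] =
  bilin_maps_right(3)[OF structure_maps(3) _ deg1.module_axioms deg1.module_axioms]
  bilin_maps_left(3)[OF structure_maps(4) _ deg1.module_axioms deg1.module_axioms]

lemma l2_l1_balanced:
  assumes "h \<in> carrier (deg1 V)" "k \<in> carrier (deg1 V)"
  shows "l2_01 V (l1 V h) k = l2_10 V h (l1 V k)"
  using algebra assms by (auto simp: leibniz2_algebras_def)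

end

locale infinity_morphism = V: leibniz2_algebra R V + W: leibniz2_algebra R W
  for R :: "('k, 'r) ring_scheme" and V W :: "('k, 'a, 'b) leibniz2" +
  fixes f :: "('a, 'b) inf_morphism"
  assumes morphism: "f \<in> inf_morphisms R V W"
begin

lemma component_maps:
  "f1_0 f \<in> lin_maps R (deg0 V) (deg0 W)"
  "f1_1 f \<in> lin_maps R (deg1 V) (deg1 W)"
  "f2 f \<in> bilin_maps R (deg0 V) (deg0 V) (deg1 W)"
  using morphism by (simp_all add: inf_morphisms_def)

lemmas closed [simp] =
  lin_mapsD(1)[OF component_maps(1)]
  lin_mapsD(1)[OF component_maps(2)]
  bilin_maps_closed[OF component_maps(3)]

lemmas add [simp] =
  lin_mapsD(2)[OF component_maps(1)]
  lin_mapsD(2)[OF component_maps(2)]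
  bilin_maps_right(1)[OF component_maps(3)]
  bilin_maps_left(1)[OF component_maps(3) _ V.deg0.module_axioms]

lemmas zero [simp] =
  lin_maps_zero[OF component_maps(2) V.deg1.module_axioms W.deg1.module_axioms]

lemma f1_l1: "h \<in> carrier (deg1 V) \<Longrightarrow> f1_0 f (l1 V h) = l1 W (f1_1 f h)"
  using morphism by (auto simp: inf_morphisms_def)

lemma f1_l2_00:
  "\<lbrakk>x \<in> carrier (deg0 V); y \<in> carrier (deg0 V)\<rbrakk> \<Longrightarrow>
   f1_0 f (l2_00 V x y) = l2_00 W (f1_0 f x) (f1_0 f y) \<oplus>\<^bsub>deg0 W\<^esub> l1 W (f2 f x y)"
  using morphism by (auto simp: inf_morphisms_def)

lemma f1_l2_01:
  assumes "x \<in> carrier (deg0 V)" "h \<in> carrier (deg1 V)"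
  shows "f1_1 f (l2_01 V x h) = l2_01 W (f1_0 f x) (f1_1 f h) \<oplus>\<^bsub>deg1 W\<^esub> f2 f x (l1 V h)"
proof -
  have "l2_01 W (f1_0 f x) (f1_1 f h) = f1_1 f (l2_01 V x h) \<ominus>\<^bsub>deg1 W\<^esub> f2 f x (l1 V h)"
    using morphism assms by (simp add: inf_morphisms_def)
  then show ?thesis using assms by (simp add: W.deg1.eq_minus_iff)
qed

lemma f1_l2_10:
  assumes "x \<in> carrier (deg0 V)" "h \<in> carrier (deg1 V)"
  shows "f1_1 f (l2_10 V h x) = l2_10 W (f1_1 f h) (f1_0 f x) \<oplus>\<^bsub>deg1 W\<^esub> f2 f (l1 V h) x"
proof -
  have "l2_10 W (f1_1 f h) (f1_0 f x) = f1_1 f (l2_10 V h x) \<ominus>\<^bsub>deg1 W\<^esub> f2 f (l1 V h) x"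
    using morphism assms by (simp add: inf_morphisms_def)
  then show ?thesis using assms by (simp add: W.deg1.eq_minus_iff)
qed

lemma f1_l3:
  assumes "x \<in> carrier (deg0 V)" "y \<in> carrier (deg0 V)" "z \<in> carrier (deg0 V)"
  shows "l3 W (f1_0 f x) (f1_0 f y) (f1_0 f z)
      \<oplus>\<^bsub>deg1 W\<^esub> l2_01 W (f1_0 f x) (f2 f y z) \<oplus>\<^bsub>deg1 W\<^esub> f2 f x (l2_00 V y z)
    = f1_1 f (l3 V x y z)
      \<oplus>\<^bsub>deg1 W\<^esub> f2 f (l2_00 V x y) z \<oplus>\<^bsub>deg1 W\<^esub> f2 f y (l2_00 V x z)
      \<oplus>\<^bsub>deg1 W\<^esub> l2_10 W (f2 f x y) (f1_0 f z) \<oplus>\<^bsub>deg1 W\<^esub> l2_01 W (f1_0 f y) (f2 f x z)"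
proof -
  have "l3 W (f1_0 f x) (f1_0 f y) (f1_0 f z)
          \<ominus>\<^bsub>deg1 W\<^esub> l2_10 W (f2 f x y) (f1_0 f z)
          \<oplus>\<^bsub>deg1 W\<^esub> l2_01 W (f1_0 f x) (f2 f y z)
          \<ominus>\<^bsub>deg1 W\<^esub> l2_01 W (f1_0 f y) (f2 f x z) =
        f1_1 f (l3 V x y z)
          \<oplus>\<^bsub>deg1 W\<^esub> f2 f (l2_00 V x y) z
          \<ominus>\<^bsub>deg1 W\<^esub> f2 f x (l2_00 V y z)
          \<oplus>\<^bsub>deg1 W\<^esub> f2 f y (l2_00 V x z)"
    using morphism assms by (simp add: inf_morphisms_def)
  then show ?thesis using assms by (simp add: W.deg1.subtraction_free W.deg1.M.a_ac)
qed

end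

lemma inf_morphismsI:
  assumes V: "V \<in> leibniz2_algebras R" and W: "W \<in> leibniz2_algebras R"
    and lin: "f1_0 f \<in> lin_maps R (deg0 V) (deg0 W)" "f1_1 f \<in> lin_maps R (deg1 V) (deg1 W)"
      "f2 f \<in> bilin_maps R (deg0 V) (deg0 V) (deg1 W)"
    and l1: "\<And>h. h \<in> carrier (deg1 V) \<Longrightarrow> f1_0 f (l1 V h) = l1 W (f1_1 f h)"
    and l2: "\<And>x y. x \<in> carrier (deg0 V) \<Longrightarrow> y \<in> carrier (deg0 V) \<Longrightarrow>
        f1_0 f (l2_00 V x y) = l2_00 W (f1_0 f x) (f1_0 f y) \<oplus>\<^bsub>deg0 W\<^esub> l1 W (f2 f x y)"
      "\<And>x h. x \<in> carrier (deg0 V) \<Longrightarrow> h \<in> carrier (deg1 V) \<Longrightarrow>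
        f1_1 f (l2_01 V x h) = l2_01 W (f1_0 f x) (f1_1 f h) \<oplus>\<^bsub>deg1 W\<^esub> f2 f x (l1 V h)"
      "\<And>x h. x \<in> carrier (deg0 V) \<Longrightarrow> h \<in> carrier (deg1 V) \<Longrightarrow>
        f1_1 f (l2_10 V h x) = l2_10 W (f1_1 f h) (f1_0 f x) \<oplus>\<^bsub>deg1 W\<^esub> f2 f (l1 V h) x"
    and l3: "\<And>x y z. x \<in> carrier (deg0 V) \<Longrightarrow> y \<in> carrier (deg0 V) \<Longrightarrow> z \<in> carrier (deg0 V) \<Longrightarrow>
        l3 W (f1_0 f x) (f1_0 f y) (f1_0 f z)
          \<oplus>\<^bsub>deg1 W\<^esub> l2_01 W (f1_0 f x) (f2 f y z) \<oplus>\<^bsub>deg1 W\<^esub> f2 f x (l2_00 V y z)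
        = f1_1 f (l3 V x y z)
          \<oplus>\<^bsub>deg1 W\<^esub> f2 f (l2_00 V x y) z \<oplus>\<^bsub>deg1 W\<^esub> f2 f y (l2_00 V x z)
          \<oplus>\<^bsub>deg1 W\<^esub> l2_10 W (f2 f x y) (f1_0 f z) \<oplus>\<^bsub>deg1 W\<^esub> l2_01 W (f1_0 f y) (f2 f x z)"
  shows "f \<in> inf_morphisms R V W"
proof -
  interpret V: leibniz2_algebra R V by unfold_locales fact
  interpret W: leibniz2_algebra R W by unfold_locales fact
  note [simp] = lin_mapsD(1)[OF lin(1)] lin_mapsD(1)[OF lin(2)] bilin_maps_closed[OF lin(3)]
  have "l3 W (f1_0 f x) (f1_0 f y) (f1_0 f z)
          \<ominus>\<^bsub>deg1 W\<^esub> l2_10 W (f2 f x y) (f1_0 f z)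
          \<oplus>\<^bsub>deg1 W\<^esub> l2_01 W (f1_0 f x) (f2 f y z)
          \<ominus>\<^bsub>deg1 W\<^esub> l2_01 W (f1_0 f y) (f2 f x z) =
        f1_1 f (l3 V x y z)
          \<oplus>\<^bsub>deg1 W\<^esub> f2 f (l2_00 V x y) z
          \<ominus>\<^bsub>deg1 W\<^esub> f2 f x (l2_00 V y z)
          \<oplus>\<^bsub>deg1 W\<^esub> f2 f y (l2_00 V x z)"
    if "x \<in> carrier (deg0 V)" "y \<in> carrier (deg0 V)" "z \<in> carrier (deg0 V)" for x y z
    using l3[OF that] that by (simp add: W.deg1.subtraction_free W.deg1.M.a_ac)
  then show ?thesis
    by (simp add: inf_morphisms_def lin l1 l2 W.deg1.eq_minus_iff)
qed

locale homotopy = f: infinity_morphism R V W f + g: infinity_morphism R V W g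
  for R :: "('k, 'r) ring_scheme" and V W :: "('k, 'a, 'b) leibniz2" and f g +
  fixes \<theta> :: "'a \<Rightarrow> 'b"
  assumes homotopy: "\<theta> \<in> homotopies R V W f g"
begin

lemma linear: "\<theta> \<in> lin_maps R (deg0 V) (deg1 W)"
  using homotopy by (simp add: homotopies_def)

lemmas closed [simp] = lin_mapsD(1)[OF linear]
lemmas add [simp] = lin_mapsD(2)[OF linear]

lemma target_f1_0:
  assumes "x \<in> carrier (deg0 V)"
  shows "f1_0 g x = f1_0 f x \<oplus>\<^bsub>deg0 W\<^esub> l1 W (\<theta> x)"
proof -
  have "f1_0 g x \<ominus>\<^bsub>deg0 W\<^esub> f1_0 f x = l1 W (\<theta> x)"
    using homotopy assms by (simp add: homotopies_def)
  then show ?thesis using assms by (simp add: f.W.deg0.minus_eq_iff f.W.deg0.M.a_ac)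
qed

lemma target_f1_1:
  assumes "h \<in> carrier (deg1 V)"
  shows "f1_1 g h = f1_1 f h \<oplus>\<^bsub>deg1 W\<^esub> \<theta> (l1 V h)"
proof -
  have "f1_1 g h \<ominus>\<^bsub>deg1 W\<^esub> f1_1 f h = \<theta> (l1 V h)"
    using homotopy assms by (simp add: homotopies_def)
  then show ?thesis using assms by (simp add: f.W.deg1.minus_eq_iff f.W.deg1.M.a_ac)
qed

lemma target_f2:
  assumes "x \<in> carrier (deg0 V)" "y \<in> carrier (deg0 V)"
  shows "f2 g x y \<oplus>\<^bsub>deg1 W\<^esub> l2_01 W (f1_0 f x) (\<theta> y) \<oplus>\<^bsub>deg1 W\<^esub> l2_10 W (\<theta> x) (f1_0 g y)
    = f2 f x y \<oplus>\<^bsub>deg1 W\<^esub> \<theta> (l2_00 V x y)"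
proof -
  have "f2 g x y \<ominus>\<^bsub>deg1 W\<^esub> f2 f x y = \<theta> (l2_00 V x y)
      \<ominus>\<^bsub>deg1 W\<^esub> l2_01 W (f1_0 f x) (\<theta> y) \<ominus>\<^bsub>deg1 W\<^esub> l2_10 W (\<theta> x) (f1_0 g y)"
    using homotopy assms by (simp add: homotopies_def)
  then show ?thesis using assms by (simp add: f.W.deg1.subtraction_free f.W.deg1.M.a_ac)
qed

end

lemma homotopiesI:
  assumes f: "infinity_morphism R V W f" and g: "infinity_morphism R V W g"
    and lin: "\<theta> \<in> lin_maps R (deg0 V) (deg1 W)"
    and "\<And>x. x \<in> carrier (deg0 V) \<Longrightarrow> f1_0 g x = f1_0 f x \<oplus>\<^bsub>deg0 W\<^esub> l1 W (\<theta> x)"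
    and "\<And>h. h \<in> carrier (deg1 V) \<Longrightarrow> f1_1 g h = f1_1 f h \<oplus>\<^bsub>deg1 W\<^esub> \<theta> (l1 V h)"
    and f2: "\<And>x y. x \<in> carrier (deg0 V) \<Longrightarrow> y \<in> carrier (deg0 V) \<Longrightarrow>
      f2 g x y \<oplus>\<^bsub>deg1 W\<^esub> l2_01 W (f1_0 f x) (\<theta> y) \<oplus>\<^bsub>deg1 W\<^esub> l2_10 W (\<theta> x) (f1_0 g y)
      = f2 f x y \<oplus>\<^bsub>deg1 W\<^esub> \<theta> (l2_00 V x y)"
  shows "\<theta> \<in> homotopies R V W f g"
proof -
  interpret f: infinity_morphism R V W f by fact
  interpret g: infinity_morphism R V W g by fact
  note [simp] = lin_mapsD(1)[OF lin]
  have "f1_0 g x \<ominus>\<^bsub>deg0 W\<^esub> f1_0 f x = l1 W (\<theta> x)" if "x \<in> carrier (deg0 V)" for x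
    using assms(4)[OF that] that
    by (subst f.W.deg0.minus_eq_iff) (simp_all add: f.W.deg0.M.a_ac)
  moreover have "f1_1 g h \<ominus>\<^bsub>deg1 W\<^esub> f1_1 f h = \<theta> (l1 V h)" if "h \<in> carrier (deg1 V)" for h
    using assms(5)[OF that] that
    by (subst f.W.deg1.minus_eq_iff) (simp_all add: f.W.deg1.M.a_ac)
  moreover have "f2 g x y \<ominus>\<^bsub>deg1 W\<^esub> f2 f x y = \<theta> (l2_00 V x y)
      \<ominus>\<^bsub>deg1 W\<^esub> l2_01 W (f1_0 f x) (\<theta> y) \<ominus>\<^bsub>deg1 W\<^esub> l2_10 W (\<theta> x) (f1_0 g y)"
    if "x \<in> carrier (deg0 V)" "y \<in> carrier (deg0 V)" for x y
    using f2[OF that] that by (simp add: f.W.deg1.subtraction_free f.W.deg1.M.a_ac)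
  ultimately show ?thesis using lin by (simp add: homotopies_def)
qed

section \<open>The category of infinity morphisms\<close>

lemma inf_morphism_eqI:
  assumes f: "f \<in> inf_morphisms R V W" and g: "g \<in> inf_morphisms R V W"
    and "\<And>x. x \<in> carrier (deg0 V) \<Longrightarrow> f1_0 f x = f1_0 g x"
    and "\<And>h. h \<in> carrier (deg1 V) \<Longrightarrow> f1_1 f h = f1_1 g h"
    and "\<And>x y. x \<in> carrier (deg0 V) \<Longrightarrow> y \<in> carrier (deg0 V) \<Longrightarrow> f2 f x y = f2 g x y"
  shows "f = g"
proof (rule inf_morphism.equality)
  show "f1_0 f = f1_0 g"
    by (rule lin_maps_eqI) (use assms in \<open>auto simp: inf_morphisms_def\<close>)
  show "f1_1 f = f1_1 g"
    by (rule lin_maps_eqI) (use assms in \<open>auto simp: inf_morphisms_def\<close>)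
  show "f2 f = f2 g"
    by (rule bilin_maps_eqI) (use assms in \<open>auto simp: inf_morphisms_def\<close>)
qed simp

lemma inf_comp_apply [simp]:
  "x \<in> carrier (deg0 V) \<Longrightarrow> f1_0 (inf_comp V W X g f) x = f1_0 g (f1_0 f x)"
  "h \<in> carrier (deg1 V) \<Longrightarrow> f1_1 (inf_comp V W X g f) h = f1_1 g (f1_1 f h)"
  "\<lbrakk>x \<in> carrier (deg0 V); y \<in> carrier (deg0 V)\<rbrakk> \<Longrightarrow>
   f2 (inf_comp V W X g f) x y = f2 g (f1_0 f x) (f1_0 f y) \<oplus>\<^bsub>deg1 X\<^esub> f1_1 g (f2 f x y)"
  by (simp_all add: inf_comp_def)

lemma inf_ident_apply [simp]:
  "x \<in> carrier (deg0 V) \<Longrightarrow> f1_0 (inf_ident V) x = x"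
  "h \<in> carrier (deg1 V) \<Longrightarrow> f1_1 (inf_ident V) h = h"
  "\<lbrakk>x \<in> carrier (deg0 V); y \<in> carrier (deg0 V)\<rbrakk> \<Longrightarrow> f2 (inf_ident V) x y = \<zero>\<^bsub>deg1 V\<^esub>"
  by (simp_all add: inf_ident_def)

text \<open>Since the second component of the identity vanishes, its coherence law is that of \<open>l\<^sub>3\<close> with
  itself.\<close>

lemma (in leibniz2_algebra) inf_ident_in_inf_morphisms: "inf_ident V \<in> inf_morphisms R V V"
proof (rule inf_morphismsI[OF algebra algebra])
  show "f1_0 (inf_ident V) \<in> lin_maps R (deg0 V) (deg0 V)"
    unfolding inf_ident_def inf_morphism.simps
    by (rule restrict_in_lin_maps[OF deg0.module_axioms]) simp_all
  show "f1_1 (inf_ident V) \<in> lin_maps R (deg1 V) (deg1 V)"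
    unfolding inf_ident_def inf_morphism.simps
    by (rule restrict_in_lin_maps[OF deg1.module_axioms]) simp_all
  show "f2 (inf_ident V) \<in> bilin_maps R (deg0 V) (deg0 V) (deg1 V)"
    unfolding inf_ident_def inf_morphism.simps
    by (rule restrict_in_bilin_maps[OF deg0.module_axioms deg0.module_axioms]) simp_all
qed simp_all

locale composable_morphisms = f: infinity_morphism R V W f + g: infinity_morphism R W X g
  for R :: "('k, 'r) ring_scheme" and V W X :: "('k, 'a, 'b) leibniz2" and f g
begin

abbreviation gf where "gf \<equiv> inf_comp V W X g f"

lemma f1_0_in_lin_maps: "f1_0 gf \<in> lin_maps R (deg0 V) (deg0 X)"
  unfolding inf_comp_def inf_morphism.simps
  by (rule lin_maps_compose[OF f.component_maps(1) g.component_maps(1) f.V.deg0.module_axioms])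

lemma f1_1_in_lin_maps: "f1_1 gf \<in> lin_maps R (deg1 V) (deg1 X)"
  unfolding inf_comp_def inf_morphism.simps
  by (rule lin_maps_compose[OF f.component_maps(2) g.component_maps(2) f.V.deg1.module_axioms])

lemma f2_in_bilin_maps: "f2 gf \<in> bilin_maps R (deg0 V) (deg0 V) (deg1 X)"
  unfolding inf_comp_def inf_morphism.simps
  by (rule restrict_in_bilin_maps[OF f.V.deg0.module_axioms f.V.deg0.module_axioms])
    (simp_all add: g.W.deg1.M.a_ac g.W.deg1.smult_r_distr
      lin_mapsD(3)[OF f.component_maps(1)] lin_mapsD(3)[OF g.component_maps(2)]
      bilin_maps_right(2)[OF f.component_maps(3)] bilin_maps_right(2)[OF g.component_maps(3)]
      bilin_maps_left(2)[OF f.component_maps(3) _ f.V.deg0.module_axioms]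
      bilin_maps_left(2)[OF g.component_maps(3) _ f.W.deg0.module_axioms])

text \<open>The sum of the coherence law of \<open>g\<close> at \<open>f\<^sub>1x, f\<^sub>1y, f\<^sub>1z\<close> and of the image under \<open>g\<^sub>1\<close> of the
  coherence law of \<open>f\<close> at \<open>x, y, z\<close>. The three terms \<open>g\<^sub>1m\<^sub>2\<close> in the latter are expanded by the laws
  of \<open>g\<close> for \<open>m\<^sub>2\<close>; the corrections \<open>g\<^sub>2(m\<^sub>1f\<^sub>2, f\<^sub>1)\<close> and \<open>g\<^sub>2(f\<^sub>1, m\<^sub>1f\<^sub>2)\<close> complete the terms
  \<open>g\<^sub>2(m\<^sub>2, f\<^sub>1)\<close> and \<open>g\<^sub>2(f\<^sub>1, m\<^sub>2)\<close> of the former to \<open>g\<^sub>2(f\<^sub>1l\<^sub>2, f\<^sub>1)\<close> and \<open>g\<^sub>2(f\<^sub>1, f\<^sub>1l\<^sub>2)\<close>.\<close>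

lemma inf_comp_l3:
  assumes [simp]: "x \<in> carrier (deg0 V)" "y \<in> carrier (deg0 V)" "z \<in> carrier (deg0 V)"
  shows "l3 X (f1_0 gf x) (f1_0 gf y) (f1_0 gf z)
      \<oplus>\<^bsub>deg1 X\<^esub> l2_01 X (f1_0 gf x) (f2 gf y z) \<oplus>\<^bsub>deg1 X\<^esub> f2 gf x (l2_00 V y z)
    = f1_1 gf (l3 V x y z)
      \<oplus>\<^bsub>deg1 X\<^esub> f2 gf (l2_00 V x y) z \<oplus>\<^bsub>deg1 X\<^esub> f2 gf y (l2_00 V x z)
      \<oplus>\<^bsub>deg1 X\<^esub> l2_10 X (f2 gf x y) (f1_0 gf z) \<oplus>\<^bsub>deg1 X\<^esub> l2_01 X (f1_0 gf y) (f2 gf x z)"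
    (is "?lhs = ?rhs")
proof -
  let ?x = "f1_0 f x" and ?y = "f1_0 f y" and ?z = "f1_0 f z"
  \<comment> \<open>The law of \<open>g\<close> reads \<open>p = m + q\<close> and the image of the law of \<open>f\<close> reads \<open>m + s = t\<close>. The
    shared term \<open>m\<close> drops out of \<open>p + s = t + q\<close>.\<close>
  define m where "m = f1_1 g (l3 W ?x ?y ?z)"
  define p where "p = l3 X (f1_0 g ?x) (f1_0 g ?y) (f1_0 g ?z)
      \<oplus>\<^bsub>deg1 X\<^esub> l2_01 X (f1_0 g ?x) (f2 g ?y ?z) \<oplus>\<^bsub>deg1 X\<^esub> f2 g ?x (l2_00 W ?y ?z)"
  define q where "q = f2 g (l2_00 W ?x ?y) ?z \<oplus>\<^bsub>deg1 X\<^esub> f2 g ?y (l2_00 W ?x ?z)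
      \<oplus>\<^bsub>deg1 X\<^esub> l2_10 X (f2 g ?x ?y) (f1_0 g ?z) \<oplus>\<^bsub>deg1 X\<^esub> l2_01 X (f1_0 g ?y) (f2 g ?x ?z)"
  define s where "s = f1_1 g (l2_01 W ?x (f2 f y z)) \<oplus>\<^bsub>deg1 X\<^esub> f1_1 g (f2 f x (l2_00 V y z))"
  define t where "t = f1_1 g (f1_1 f (l3 V x y z))
      \<oplus>\<^bsub>deg1 X\<^esub> f1_1 g (f2 f (l2_00 V x y) z) \<oplus>\<^bsub>deg1 X\<^esub> f1_1 g (f2 f y (l2_00 V x z))
      \<oplus>\<^bsub>deg1 X\<^esub> f1_1 g (l2_10 W (f2 f x y) ?z) \<oplus>\<^bsub>deg1 X\<^esub> f1_1 g (l2_01 W ?y (f2 f x z))"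
  have closed: "m \<in> carrier (deg1 X)" "p \<in> carrier (deg1 X)" "q \<in> carrier (deg1 X)"
    "s \<in> carrier (deg1 X)" "t \<in> carrier (deg1 X)"
    by (simp_all add: m_def p_def q_def s_def t_def)
  have p: "p = m \<oplus>\<^bsub>deg1 X\<^esub> q"
    using g.f1_l3[of ?x ?y ?z] by (simp add: m_def p_def q_def g.W.deg1.M.a_ac)
  have t: "m \<oplus>\<^bsub>deg1 X\<^esub> s = t"
    using arg_cong[OF f.f1_l3[of x y z], of "f1_1 g"]
    by (simp add: m_def s_def t_def g.W.deg1.M.a_ac)
  have "?lhs = p \<oplus>\<^bsub>deg1 X\<^esub> s"
    by (simp add: p_def s_def f.f1_l2_00 g.f1_l2_01 g.W.deg1.M.a_ac)
  also have "\<dots> = t \<oplus>\<^bsub>deg1 X\<^esub> q"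
    using closed by (simp add: p t[symmetric] g.W.deg1.M.a_ac)
  also have "\<dots> = ?rhs"
    by (simp add: q_def t_def f.f1_l2_00 g.f1_l2_01 g.f1_l2_10 g.W.deg1.M.a_ac)
  finally show ?thesis .
qed

lemma inf_comp_in_inf_morphisms: "gf \<in> inf_morphisms R V X"
proof (rule inf_morphismsI[OF f.V.algebra g.W.algebra f1_0_in_lin_maps f1_1_in_lin_maps
      f2_in_bilin_maps])
  show "f1_0 gf (l1 V h) = l1 X (f1_1 gf h)" if "h \<in> carrier (deg1 V)" for h
    using that by (simp add: f.f1_l1 g.f1_l1)
  show "f1_0 gf (l2_00 V x y)
      = l2_00 X (f1_0 gf x) (f1_0 gf y) \<oplus>\<^bsub>deg0 X\<^esub> l1 X (f2 gf x y)"
    if "x \<in> carrier (deg0 V)" "y \<in> carrier (deg0 V)" for x y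
    using that by (simp add: f.f1_l2_00 g.f1_l2_00 g.f1_l1 g.W.deg0.M.a_ac)
  show "f1_1 gf (l2_01 V x h)
      = l2_01 X (f1_0 gf x) (f1_1 gf h) \<oplus>\<^bsub>deg1 X\<^esub> f2 gf x (l1 V h)"
    if "x \<in> carrier (deg0 V)" "h \<in> carrier (deg1 V)" for x h
    using that by (simp add: f.f1_l2_01 g.f1_l2_01 f.f1_l1 g.W.deg1.M.a_ac)
  show "f1_1 gf (l2_10 V h x)
      = l2_10 X (f1_1 gf h) (f1_0 gf x) \<oplus>\<^bsub>deg1 X\<^esub> f2 gf (l1 V h) x"
    if "x \<in> carrier (deg0 V)" "h \<in> carrier (deg1 V)" for x h
    using that by (simp add: f.f1_l2_10 g.f1_l2_10 f.f1_l1 g.W.deg1.M.a_ac)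
qed (rule inf_comp_l3)

sublocale gf: infinity_morphism R V X gf
  by unfold_locales (rule inf_comp_in_inf_morphisms)

end

lemmas infinity_morphismI =
  infinity_morphism.intro[OF leibniz2_algebra.intro leibniz2_algebra.intro infinity_morphism_axioms.intro]

lemma composable_morphismsI:
  assumes "V \<in> leibniz2_algebras R" "W \<in> leibniz2_algebras R" "X \<in> leibniz2_algebras R"
    and "f \<in> inf_morphisms R V W" "g \<in> inf_morphisms R W X"
  shows "composable_morphisms R V W X f g"
  by (intro composable_morphisms.intro infinity_morphismI assms)

lemma category_inf_morphisms:
  "category (leibniz2_algebras R) (inf_morphisms R) inf_comp inf_ident"
proof (rule category.intro)
  fix V W X Y :: "('a, 'b, 'c) leibniz2" and f g h
  assume V: "V \<in> leibniz2_algebras R" and W: "W \<in> leibniz2_algebras R"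
  interpret V: leibniz2_algebra R V by unfold_locales fact
  interpret W: leibniz2_algebra R W by unfold_locales fact
  show "inf_ident V \<in> inf_morphisms R V V"
    by (rule V.inf_ident_in_inf_morphisms)
  assume f: "f \<in> inf_morphisms R V W"
  interpret f: infinity_morphism R V W f by unfold_locales fact
  interpret idf: composable_morphisms R V W W f "inf_ident W"
    by (intro composable_morphismsI V W f W.inf_ident_in_inf_morphisms)
  show "inf_comp V W W (inf_ident W) f = f"
    by (rule inf_morphism_eqI[OF idf.inf_comp_in_inf_morphisms f]) simp_all
  interpret fid: composable_morphisms R V V W "inf_ident V" f
    by (intro composable_morphismsI V W f V.inf_ident_in_inf_morphisms)
  show "inf_comp V V W f (inf_ident V) = f"
    by (rule inf_morphism_eqI[OF fid.inf_comp_in_inf_morphisms f]) simp_all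
  assume X: "X \<in> leibniz2_algebras R" and g: "g \<in> inf_morphisms R W X"
  interpret gf: composable_morphisms R V W X f g by (rule composable_morphismsI[OF V W X f g])
  show "inf_comp V W X g f \<in> inf_morphisms R V X"
    by (rule gf.inf_comp_in_inf_morphisms)
  assume Y: "Y \<in> leibniz2_algebras R" and h: "h \<in> inf_morphisms R X Y"
  interpret hg: composable_morphisms R W X Y g h by (rule composable_morphismsI[OF W X Y g h])
  interpret hg_f: composable_morphisms R V W Y f "inf_comp W X Y h g"
    by (rule composable_morphismsI[OF V W Y f hg.inf_comp_in_inf_morphisms])
  interpret h_gf: composable_morphisms R V X Y "inf_comp V W X g f" h
    by (rule composable_morphismsI[OF V X Y gf.inf_comp_in_inf_morphisms h])
  show "inf_comp V W Y (inf_comp W X Y h g) f = inf_comp V X Y h (inf_comp V W X g f)"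
    by (rule inf_morphism_eqI[OF hg_f.inf_comp_in_inf_morphisms h_gf.inf_comp_in_inf_morphisms])
      (simp_all add: hg.g.W.deg1.M.a_ac)
qed


section \<open>Vertical composition\<close>

lemmas homotopyI = homotopy.intro[OF infinity_morphismI infinity_morphismI homotopy_axioms.intro]

lemma homotopy_eqI:
  assumes "\<theta> \<in> homotopies R V W f g" "\<tau> \<in> homotopies R V W f g"
    and "\<And>x. x \<in> carrier (deg0 V) \<Longrightarrow> \<theta> x = \<tau> x"
  shows "\<theta> = \<tau>"
  by (rule lin_maps_eqI) (use assms in \<open>auto simp: homotopies_def\<close>)

lemma (in infinity_morphism) homotopy_zero_in_homotopies:
  "homotopy_zero V W \<in> homotopies R V W f f"
proof (rule homotopiesI)
  show "homotopy_zero V W \<in> lin_maps R (deg0 V) (deg1 W)"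
    unfolding homotopy_zero_def by (rule restrict_in_lin_maps[OF V.deg0.module_axioms]) simp_all
qed (unfold_locales, simp_all add: homotopy_zero_def)

text \<open>The equations for \<open>f\<^sub>2\<close> of \<open>\<theta>\<close> and \<open>\<tau>\<close> add up to that of \<open>\<tau> + \<theta>\<close> once the middle morphism \<open>g\<close>
  is replaced by \<open>f\<close> in \<open>m\<^sub>2(g\<^sub>1x, \<tau>y)\<close> and by \<open>h\<close> in \<open>m\<^sub>2(\<theta>x, g\<^sub>1y)\<close>. These replacements cost
  \<open>m\<^sub>2(m\<^sub>1\<theta>x, \<tau>y)\<close> and \<open>m\<^sub>2(\<theta>x, m\<^sub>1\<tau>y)\<close>, which are equal.\<close>

lemma homotopy_vcomp_in_homotopies:
  assumes "homotopy R V W f g \<theta>" "homotopy R V W g h \<tau>"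
  shows "homotopy_vcomp V W \<tau> \<theta> \<in> homotopies R V W f h"
proof -
  interpret \<theta>: homotopy R V W f g \<theta> by fact
  interpret \<tau>: homotopy R V W g h \<tau> by fact
  note ac = \<theta>.f.W.deg1.M.a_ac
  show ?thesis
  proof (rule homotopiesI)
    show "homotopy_vcomp V W \<tau> \<theta> \<in> lin_maps R (deg0 V) (deg1 W)"
      unfolding homotopy_vcomp_def
      by (rule lin_maps_add[OF \<tau>.linear \<theta>.linear \<theta>.f.V.deg0.module_axioms
            \<theta>.f.W.deg1.module_axioms])
    show "f1_0 h x = f1_0 f x \<oplus>\<^bsub>deg0 W\<^esub> l1 W (homotopy_vcomp V W \<tau> \<theta> x)"
      if "x \<in> carrier (deg0 V)" for x
      using that
      by (simp add: homotopy_vcomp_def \<theta>.target_f1_0 \<tau>.target_f1_0 \<theta>.f.W.deg0.M.a_ac)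
    show "f1_1 h k = f1_1 f k \<oplus>\<^bsub>deg1 W\<^esub> homotopy_vcomp V W \<tau> \<theta> (l1 V k)"
      if "k \<in> carrier (deg1 V)" for k
      using that by (simp add: homotopy_vcomp_def \<theta>.target_f1_1 \<tau>.target_f1_1 ac)
    fix x y assume [simp]: "x \<in> carrier (deg0 V)" "y \<in> carrier (deg0 V)"
    have cross: "l2_01 W (l1 W (\<theta> x)) (\<tau> y) = l2_10 W (\<theta> x) (l1 W (\<tau> y))"
      by (simp add: \<theta>.f.W.l2_l1_balanced)
    have 1: "f2 h x y \<oplus>\<^bsub>deg1 W\<^esub> l2_01 W (f1_0 f x) (\<tau> y)
          \<oplus>\<^bsub>deg1 W\<^esub> l2_10 W (\<theta> x) (l1 W (\<tau> y)) \<oplus>\<^bsub>deg1 W\<^esub> l2_10 W (\<tau> x) (f1_0 h y)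
        = f2 g x y \<oplus>\<^bsub>deg1 W\<^esub> \<tau> (l2_00 V x y)"
      using \<tau>.target_f2[of x y] by (simp add: \<theta>.target_f1_0[of x] cross ac)
    have 2: "l2_10 W (\<theta> x) (f1_0 h y)
        = l2_10 W (\<theta> x) (f1_0 g y) \<oplus>\<^bsub>deg1 W\<^esub> l2_10 W (\<theta> x) (l1 W (\<tau> y))"
      by (simp add: \<tau>.target_f1_0[of y])
    let ?\<tau>\<theta> = "homotopy_vcomp V W \<tau> \<theta>"
    have "f2 h x y \<oplus>\<^bsub>deg1 W\<^esub> l2_01 W (f1_0 f x) (?\<tau>\<theta> y) \<oplus>\<^bsub>deg1 W\<^esub> l2_10 W (?\<tau>\<theta> x) (f1_0 h y)
        = (f2 h x y \<oplus>\<^bsub>deg1 W\<^esub> l2_01 W (f1_0 f x) (\<tau> y)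
            \<oplus>\<^bsub>deg1 W\<^esub> l2_10 W (\<theta> x) (l1 W (\<tau> y)) \<oplus>\<^bsub>deg1 W\<^esub> l2_10 W (\<tau> x) (f1_0 h y))
          \<oplus>\<^bsub>deg1 W\<^esub> (l2_01 W (f1_0 f x) (\<theta> y) \<oplus>\<^bsub>deg1 W\<^esub> l2_10 W (\<theta> x) (f1_0 g y))"
      by (simp add: homotopy_vcomp_def 2 ac)
    also have "\<dots> = (f2 g x y \<oplus>\<^bsub>deg1 W\<^esub> l2_01 W (f1_0 f x) (\<theta> y)
          \<oplus>\<^bsub>deg1 W\<^esub> l2_10 W (\<theta> x) (f1_0 g y)) \<oplus>\<^bsub>deg1 W\<^esub> \<tau> (l2_00 V x y)"
      unfolding 1 by (simp add: ac)
    also have "\<dots> = f2 f x y \<oplus>\<^bsub>deg1 W\<^esub> ?\<tau>\<theta> (l2_00 V x y)"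
      by (subst \<theta>.target_f2) (simp_all add: homotopy_vcomp_def ac)
    finally show "f2 h x y \<oplus>\<^bsub>deg1 W\<^esub> l2_01 W (f1_0 f x) (?\<tau>\<theta> y)
        \<oplus>\<^bsub>deg1 W\<^esub> l2_10 W (?\<tau>\<theta> x) (f1_0 h y)
        = f2 f x y \<oplus>\<^bsub>deg1 W\<^esub> ?\<tau>\<theta> (l2_00 V x y)" .
  qed unfold_locales
qed

lemma category_homotopies:
  assumes V: "V \<in> leibniz2_algebras R" and W: "W \<in> leibniz2_algebras R"
  shows "category (inf_morphisms R V W) (homotopies R V W)
           (\<lambda>f g h. homotopy_vcomp V W) (\<lambda>f. homotopy_zero V W)"
proof (rule category.intro)
  fix f g h k \<theta> \<tau> \<sigma>
  assume f: "f \<in> inf_morphisms R V W"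
  interpret f: infinity_morphism R V W f by (rule infinity_morphismI[OF V W f])
  show "homotopy_zero V W \<in> homotopies R V W f f"
    by (rule f.homotopy_zero_in_homotopies)
  assume g: "g \<in> inf_morphisms R V W" and \<theta>: "\<theta> \<in> homotopies R V W f g"
  interpret \<theta>: homotopy R V W f g \<theta> by (rule homotopyI[OF V W f V W g \<theta>])
  have "homotopy_vcomp V W (homotopy_zero V W) \<theta> \<in> homotopies R V W f g"
    by (rule homotopy_vcomp_in_homotopies[OF \<theta>.homotopy_axioms homotopyI])
      (intro V W g \<theta>.g.homotopy_zero_in_homotopies)+
  then show "homotopy_vcomp V W (homotopy_zero V W) \<theta> = \<theta>"
    by (rule homotopy_eqI[OF _ \<theta>]) (simp add: homotopy_vcomp_def homotopy_zero_def)
  have "homotopy_vcomp V W \<theta> (homotopy_zero V W) \<in> homotopies R V W f g"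
    by (rule homotopy_vcomp_in_homotopies[OF homotopyI \<theta>.homotopy_axioms])
      (intro V W f f.homotopy_zero_in_homotopies)+
  then show "homotopy_vcomp V W \<theta> (homotopy_zero V W) = \<theta>"
    by (rule homotopy_eqI[OF _ \<theta>]) (simp add: homotopy_vcomp_def homotopy_zero_def)
  assume h: "h \<in> inf_morphisms R V W" and \<tau>: "\<tau> \<in> homotopies R V W g h"
  interpret \<tau>: homotopy R V W g h \<tau> by (rule homotopyI[OF V W g V W h \<tau>])
  show "homotopy_vcomp V W \<tau> \<theta> \<in> homotopies R V W f h"
    by (rule homotopy_vcomp_in_homotopies[OF \<theta>.homotopy_axioms \<tau>.homotopy_axioms])
  assume k: "k \<in> inf_morphisms R V W" and \<sigma>: "\<sigma> \<in> homotopies R V W h k"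
  interpret \<sigma>: homotopy R V W h k \<sigma> by (rule homotopyI[OF V W h V W k \<sigma>])
  show "homotopy_vcomp V W (homotopy_vcomp V W \<sigma> \<tau>) \<theta>
      = homotopy_vcomp V W \<sigma> (homotopy_vcomp V W \<tau> \<theta>)"
    by (auto simp: homotopy_vcomp_def f.W.deg1.M.a_ac intro!: restrict_ext)
qed


section \<open>Horizontal composition\<close>

text \<open>The term \<open>\<tau>f\<^sub>1l\<^sub>2\<close> splits as \<open>\<tau>m\<^sub>2(f\<^sub>1, f\<^sub>1) + \<tau>m\<^sub>1f\<^sub>2\<close>. The first summand enters the law of \<open>\<tau>\<close> at
  \<open>f\<^sub>1x, f\<^sub>1y\<close>, and the second is \<open>g'\<^sub>1f\<^sub>2 - f'\<^sub>1f\<^sub>2\<close>.\<close>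

lemma whisker_right_in_homotopies:
  assumes "infinity_morphism R V W f" "homotopy R W X f' g' \<tau>"
  shows "(\<lambda>x\<in>carrier (deg0 V). \<tau> (f1_0 f x))
    \<in> homotopies R V X (inf_comp V W X f' f) (inf_comp V W X g' f)"
proof -
  interpret f: infinity_morphism R V W f by fact
  interpret \<tau>: homotopy R W X f' g' \<tau> by fact
  interpret f'f: composable_morphisms R V W X f f' by unfold_locales
  interpret g'f: composable_morphisms R V W X f g' by unfold_locales
  note ac = \<tau>.f.W.deg1.M.a_ac
  show ?thesis
  proof (rule homotopiesI[OF f'f.gf.infinity_morphism_axioms g'f.gf.infinity_morphism_axioms
        lin_maps_compose[OF f.component_maps(1) \<tau>.linear f.V.deg0.module_axioms]], goal_cases)
    case (1 x)
    then show ?case by (simp add: \<tau>.target_f1_0)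
  next
    case (2 h)
    then show ?case by (simp add: \<tau>.target_f1_1 f.f1_l1)
  next
    case (3 x y)
    note [simp] = 3
    let ?x = "f1_0 f x" and ?y = "f1_0 f y" and ?h = "f2 f x y"
    have "f2 g' ?x ?y \<oplus>\<^bsub>deg1 X\<^esub> f1_1 g' ?h
          \<oplus>\<^bsub>deg1 X\<^esub> l2_01 X (f1_0 f' ?x) (\<tau> ?y) \<oplus>\<^bsub>deg1 X\<^esub> l2_10 X (\<tau> ?x) (f1_0 g' ?y)
        = (f2 g' ?x ?y \<oplus>\<^bsub>deg1 X\<^esub> l2_01 X (f1_0 f' ?x) (\<tau> ?y)
            \<oplus>\<^bsub>deg1 X\<^esub> l2_10 X (\<tau> ?x) (f1_0 g' ?y)) \<oplus>\<^bsub>deg1 X\<^esub> f1_1 g' ?h"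
      by (simp add: ac)
    also have "\<dots> = f2 f' ?x ?y \<oplus>\<^bsub>deg1 X\<^esub> f1_1 f' ?h \<oplus>\<^bsub>deg1 X\<^esub> \<tau> (f1_0 f (l2_00 V x y))"
      by (subst \<tau>.target_f2) (simp_all add: \<tau>.target_f1_1 f.f1_l2_00 ac)
    finally show ?case by simp
  qed
qed

text \<open>Applying \<open>g'\<^sub>1\<close> to the law of \<open>\<theta>\<close> produces the corrections \<open>g'\<^sub>2(f\<^sub>1x, m\<^sub>1\<theta>y)\<close> and
  \<open>g'\<^sub>2(m\<^sub>1\<theta>x, g\<^sub>1y)\<close>. As \<open>m\<^sub>1\<theta> = g\<^sub>1 - f\<^sub>1\<close>, they telescope to \<open>g'\<^sub>2(g\<^sub>1x, g\<^sub>1y) - g'\<^sub>2(f\<^sub>1x, f\<^sub>1y)\<close>.\<close>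

lemma whisker_left_in_homotopies:
  assumes "homotopy R V W f g \<theta>" "infinity_morphism R W X g'"
  shows "(\<lambda>x\<in>carrier (deg0 V). f1_1 g' (\<theta> x))
    \<in> homotopies R V X (inf_comp V W X g' f) (inf_comp V W X g' g)"
proof -
  interpret \<theta>: homotopy R V W f g \<theta> by fact
  interpret g': infinity_morphism R W X g' by fact
  interpret g'f: composable_morphisms R V W X f g' by unfold_locales
  interpret g'g: composable_morphisms R V W X g g' by unfold_locales
  note ac = g'.W.deg1.M.a_ac
  show ?thesis
  proof (rule homotopiesI[OF g'f.gf.infinity_morphism_axioms g'g.gf.infinity_morphism_axioms
        lin_maps_compose[OF \<theta>.linear g'.component_maps(2) \<theta>.f.V.deg0.module_axioms]], goal_cases)
    case (1 x)
    then show ?case by (simp add: \<theta>.target_f1_0 g'.f1_l1)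
  next
    case (2 h)
    then show ?case by (simp add: \<theta>.target_f1_1)
  next
    case (3 x y)
    note [simp] = 3
    let ?a = "l2_01 W (f1_0 f x) (\<theta> y)" and ?b = "l2_10 W (\<theta> x) (f1_0 g y)"
    have "f2 g' (f1_0 g x) (f1_0 g y) = f2 g' (f1_0 f x) (f1_0 f y)
        \<oplus>\<^bsub>deg1 X\<^esub> f2 g' (f1_0 f x) (l1 W (\<theta> y)) \<oplus>\<^bsub>deg1 X\<^esub> f2 g' (l1 W (\<theta> x)) (f1_0 g y)"
      \<comment> \<open>The argument \<open>g\<^sub>1y\<close> also occurs on the right, so \<open>g\<^sub>1x\<close> is expanded before it.\<close>
      by (simp add: \<theta>.target_f1_0[of x]) (simp add: \<theta>.target_f1_0[of y] ac)
    then have "f2 g' (f1_0 g x) (f1_0 g y) \<oplus>\<^bsub>deg1 X\<^esub> f1_1 g' (f2 g x y)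
          \<oplus>\<^bsub>deg1 X\<^esub> l2_01 X (f1_0 g' (f1_0 f x)) (f1_1 g' (\<theta> y))
          \<oplus>\<^bsub>deg1 X\<^esub> l2_10 X (f1_1 g' (\<theta> x)) (f1_0 g' (f1_0 g y))
        = f2 g' (f1_0 f x) (f1_0 f y)
          \<oplus>\<^bsub>deg1 X\<^esub> (f1_1 g' (f2 g x y) \<oplus>\<^bsub>deg1 X\<^esub> f1_1 g' ?a \<oplus>\<^bsub>deg1 X\<^esub> f1_1 g' ?b)"
      by (simp add: g'.f1_l2_01 g'.f1_l2_10 ac)
    also have "f1_1 g' (f2 g x y) \<oplus>\<^bsub>deg1 X\<^esub> f1_1 g' ?a \<oplus>\<^bsub>deg1 X\<^esub> f1_1 g' ?b
        = f1_1 g' (f2 f x y) \<oplus>\<^bsub>deg1 X\<^esub> f1_1 g' (\<theta> (l2_00 V x y))"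
      using arg_cong[OF \<theta>.target_f2[of x y], of "f1_1 g'"] by simp
    finally show ?case by (simp add: ac)
  qed
qed

text \<open>The horizontal composite is the vertical composite of two whiskerings, through \<open>g'f\<close>.\<close>

lemma homotopy_hcomp_in_homotopies:
  assumes "homotopy R V W f g \<theta>" "homotopy R W X f' g' \<tau>"
  shows "homotopy_hcomp V X g' f \<tau> \<theta>
    \<in> homotopies R V X (inf_comp V W X f' f) (inf_comp V W X g' g)"
proof -
  interpret \<theta>: homotopy R V W f g \<theta> by fact
  interpret \<tau>: homotopy R W X f' g' \<tau> by fact
  interpret f'f: composable_morphisms R V W X f f' by unfold_locales
  interpret g'f: composable_morphisms R V W X f g' by unfold_locales
  interpret g'g: composable_morphisms R V W X g g' by unfold_locales
  interpret \<tau>f: homotopy R V X f'f.gf g'f.gf "\<lambda>x\<in>carrier (deg0 V). \<tau> (f1_0 f x)"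
    by unfold_locales
      (rule whisker_right_in_homotopies[OF \<theta>.f.infinity_morphism_axioms \<tau>.homotopy_axioms])
  interpret g'\<theta>: homotopy R V X g'f.gf g'g.gf "\<lambda>x\<in>carrier (deg0 V). f1_1 g' (\<theta> x)"
    by unfold_locales
      (rule whisker_left_in_homotopies[OF \<theta>.homotopy_axioms \<tau>.g.infinity_morphism_axioms])
  have "homotopy_hcomp V X g' f \<tau> \<theta> = homotopy_vcomp V X
      (\<lambda>x\<in>carrier (deg0 V). f1_1 g' (\<theta> x)) (\<lambda>x\<in>carrier (deg0 V). \<tau> (f1_0 f x))"
    by (auto simp: homotopy_hcomp_def homotopy_vcomp_def)
  then show ?thesis
    using homotopy_vcomp_in_homotopies[OF \<tau>f.homotopy_axioms g'\<theta>.homotopy_axioms] by simp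
qed

text \<open>Both sides equal \<open>f'\<^sub>1\<theta>x + \<tau>m\<^sub>1\<theta>x + \<tau>f\<^sub>1x\<close>: the map \<open>\<tau>m\<^sub>1\<close> measures the difference of \<open>f'\<^sub>1\<close> and
  \<open>g'\<^sub>1\<close>, and \<open>m\<^sub>1\<theta>\<close> that of \<open>f\<^sub>1\<close> and \<open>g\<^sub>1\<close>.\<close>

lemma whisker_exchange:
  assumes "homotopy R V W f g \<theta>" "homotopy R W X f' g' \<tau>" "x \<in> carrier (deg0 V)"
  shows "f1_1 g' (\<theta> x) \<oplus>\<^bsub>deg1 X\<^esub> \<tau> (f1_0 f x) = f1_1 f' (\<theta> x) \<oplus>\<^bsub>deg1 X\<^esub> \<tau> (f1_0 g x)"
proof -
  interpret \<theta>: homotopy R V W f g \<theta> by fact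
  interpret \<tau>: homotopy R W X f' g' \<tau> by fact
  show ?thesis
    using assms(3) by (simp add: \<tau>.target_f1_1 \<theta>.target_f1_0 \<tau>.f.W.deg1.M.a_ac)
qed

lemma homotopy_hcomp_exchange:
  assumes "homotopy R V W f g \<theta>" "homotopy R W X f' g' \<tau>"
  shows "homotopy_hcomp V X g' f \<tau> \<theta> = homotopy_hcomp V X f' g \<tau> \<theta>"
  unfolding homotopy_hcomp_def by (rule restrict_ext) (rule whisker_exchange[OF assms])

text \<open>The two sides traverse \<open>\<theta>\<close> and \<open>\<tau>'\<close> in opposite orders, which is an instance of
  \<open>whisker_exchange\<close>; the other terms agree.\<close>

lemma homotopy_interchange:
  assumes "homotopy R V W f g \<theta>" "homotopy R V W g h \<theta>'"
    and "homotopy R W X f' g' \<tau>" "homotopy R W X g' h' \<tau>'"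
  shows "homotopy_hcomp V X h' f (homotopy_vcomp W X \<tau>' \<tau>) (homotopy_vcomp V W \<theta>' \<theta>)
    = homotopy_vcomp V X (homotopy_hcomp V X h' g \<tau>' \<theta>') (homotopy_hcomp V X g' f \<tau> \<theta>)"
proof -
  interpret \<theta>: homotopy R V W f g \<theta> by fact
  interpret \<theta>': homotopy R V W g h \<theta>' by fact
  interpret \<tau>: homotopy R W X f' g' \<tau> by fact
  interpret \<tau>': homotopy R W X g' h' \<tau>' by fact
  note ac = \<tau>.f.W.deg1.M.a_ac
  have "f1_1 h' (\<theta>' x \<oplus>\<^bsub>deg1 W\<^esub> \<theta> x) \<oplus>\<^bsub>deg1 X\<^esub> (\<tau>' (f1_0 f x) \<oplus>\<^bsub>deg1 X\<^esub> \<tau> (f1_0 f x))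
      = (f1_1 h' (\<theta>' x) \<oplus>\<^bsub>deg1 X\<^esub> \<tau>' (f1_0 g x)) \<oplus>\<^bsub>deg1 X\<^esub> (f1_1 g' (\<theta> x) \<oplus>\<^bsub>deg1 X\<^esub> \<tau> (f1_0 f x))"
    if [simp]: "x \<in> carrier (deg0 V)" for x
  proof -
    have "f1_1 h' (\<theta>' x \<oplus>\<^bsub>deg1 W\<^esub> \<theta> x) \<oplus>\<^bsub>deg1 X\<^esub> (\<tau>' (f1_0 f x) \<oplus>\<^bsub>deg1 X\<^esub> \<tau> (f1_0 f x))
        = f1_1 h' (\<theta>' x) \<oplus>\<^bsub>deg1 X\<^esub> (f1_1 h' (\<theta> x) \<oplus>\<^bsub>deg1 X\<^esub> \<tau>' (f1_0 f x)) \<oplus>\<^bsub>deg1 X\<^esub> \<tau> (f1_0 f x)"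
      by (simp add: ac)
    also have "\<dots> = f1_1 h' (\<theta>' x) \<oplus>\<^bsub>deg1 X\<^esub> (f1_1 g' (\<theta> x) \<oplus>\<^bsub>deg1 X\<^esub> \<tau>' (f1_0 g x))
        \<oplus>\<^bsub>deg1 X\<^esub> \<tau> (f1_0 f x)"
      by (simp only: whisker_exchange[OF \<theta>.homotopy_axioms \<tau>'.homotopy_axioms that])
    finally show ?thesis by (simp add: ac)
  qed
  then show ?thesis
    by (auto simp: homotopy_hcomp_def homotopy_vcomp_def intro!: restrict_ext)
qed

lemma homotopy_hcomp_assoc:
  assumes "homotopy R V W f g \<theta>" "homotopy R W X f' g' \<tau>" "homotopy R X Y f'' g'' \<sigma>"
  shows "homotopy_hcomp V Y (inf_comp W X Y g'' g') f (homotopy_hcomp W Y g'' f' \<sigma> \<tau>) \<theta>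
    = homotopy_hcomp V Y g'' (inf_comp V W X f' f) \<sigma> (homotopy_hcomp V X g' f \<tau> \<theta>)"
proof -
  interpret \<theta>: homotopy R V W f g \<theta> by fact
  interpret \<tau>: homotopy R W X f' g' \<tau> by fact
  interpret \<sigma>: homotopy R X Y f'' g'' \<sigma> by fact
  show ?thesis
    by (auto simp: homotopy_hcomp_def \<sigma>.f.W.deg1.M.a_ac intro!: restrict_ext)
qed

section \<open>The strict 2-category\<close>

theorem proposition5p5p9:
  fixes R :: "('k, 'r) ring_scheme"
  assumes "char_zero_field R"
  shows "strict_2_category
           (leibniz2_algebras R :: ('k, 'a, 'b) leibniz2 set)
           (inf_morphisms R) inf_comp inf_ident
           (homotopies R)
           (\<lambda>V W f g h. homotopy_vcomp V W)
           (\<lambda>V W X f g f' g'. homotopy_hcomp V X g' f)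
           (\<lambda>V W f. homotopy_zero V W)
       \<and> (\<forall>(V :: ('k, 'a, 'b) leibniz2) \<in> leibniz2_algebras R.
          \<forall>W \<in> leibniz2_algebras R. \<forall>X \<in> leibniz2_algebras R.
          \<forall>f \<in> inf_morphisms R V W. \<forall>g \<in> inf_morphisms R V W.
          \<forall>f' \<in> inf_morphisms R W X. \<forall>g' \<in> inf_morphisms R W X.
          \<forall>\<theta> \<in> homotopies R V W f g. \<forall>\<tau> \<in> homotopies R W X f' g'.
            homotopy_hcomp V X g' f \<tau> \<theta> = homotopy_hcomp V X f' g \<tau> \<theta>)"
proof (intro conjI ballI)
  show "homotopy_hcomp V X g' f \<tau> \<theta> = homotopy_hcomp V X f' g \<tau> \<theta>"
    if "V \<in> leibniz2_algebras R" "W \<in> leibniz2_algebras R" "X \<in> leibniz2_algebras R"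
      and "f \<in> inf_morphisms R V W" "g \<in> inf_morphisms R V W"
      and "f' \<in> inf_morphisms R W X" "g' \<in> inf_morphisms R W X"
      and "\<theta> \<in> homotopies R V W f g" "\<tau> \<in> homotopies R W X f' g'"
    for V W X :: "('k, 'a, 'b) leibniz2" and f g f' g' \<theta> \<tau>
    by (rule homotopy_hcomp_exchange; rule homotopyI; fact that)
  show "strict_2_category
           (leibniz2_algebras R :: ('k, 'a, 'b) leibniz2 set)
           (inf_morphisms R) inf_comp inf_ident
           (homotopies R)
           (\<lambda>V W f g h. homotopy_vcomp V W)
           (\<lambda>V W X f g f' g'. homotopy_hcomp V X g' f)
           (\<lambda>V W f. homotopy_zero V W)"
  proof (rule strict_2_category.intro[OF category_inf_morphisms], rule strict_2_category_axioms.intro)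
    fix V W X Y :: "('k, 'a, 'b) leibniz2" and f g h f' g' h' f'' g'' \<theta> \<theta>' \<tau> \<tau>' \<sigma>
    assume V: "V \<in> leibniz2_algebras R" and W: "W \<in> leibniz2_algebras R"
    show "category (inf_morphisms R V W) (homotopies R V W)
        (\<lambda>f g h. homotopy_vcomp V W) (\<lambda>f. homotopy_zero V W)"
      by (rule category_homotopies[OF V W])
    interpret V: leibniz2_algebra R V by unfold_locales fact
    interpret W: leibniz2_algebra R W by unfold_locales fact
    assume f: "f \<in> inf_morphisms R V W"
    interpret f: infinity_morphism R V W f by unfold_locales fact
    {
      assume g: "g \<in> inf_morphisms R V W" and \<theta>: "\<theta> \<in> homotopies R V W f g"
      note H = homotopyI[OF V W f V W g \<theta>]
      interpret \<theta>: homotopy R V W f g \<theta> by (rule H)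
      \<comment> \<open>Extensionality of \<open>\<theta>\<close> gives agreement off the carrier, where a composite is undefined.\<close>
      have ext: "\<theta> = (\<lambda>x\<in>carrier (deg0 V). \<theta> x)"
        using \<theta>.linear by (auto simp: lin_maps_def PiE_def extensional_restrict)
      show "homotopy_hcomp V W (inf_ident W) f (homotopy_zero W W) \<theta> = \<theta>"
        by (subst (2) ext) (auto simp: homotopy_hcomp_def homotopy_zero_def intro!: restrict_ext)
      show "homotopy_hcomp V W g (inf_ident V) \<theta> (homotopy_zero V V) = \<theta>"
        by (subst (2) ext) (auto simp: homotopy_hcomp_def homotopy_zero_def intro!: restrict_ext)
    }
    assume X: "X \<in> leibniz2_algebras R" and f': "f' \<in> inf_morphisms R W X"
    interpret f': infinity_morphism R W X f' by (rule infinity_morphismI[OF W X f'])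
    show "homotopy_hcomp V X f' f (homotopy_zero W X) (homotopy_zero V W) = homotopy_zero V X"
      by (auto simp: homotopy_hcomp_def homotopy_zero_def intro!: restrict_ext)
    assume g: "g \<in> inf_morphisms R V W" and g': "g' \<in> inf_morphisms R W X"
      and \<theta>: "\<theta> \<in> homotopies R V W f g" and \<tau>: "\<tau> \<in> homotopies R W X f' g'"
    note \<theta>_homotopy = homotopyI[OF V W f V W g \<theta>] and \<tau>_homotopy = homotopyI[OF W X f' W X g' \<tau>]
    show "homotopy_hcomp V X g' f \<tau> \<theta>
        \<in> homotopies R V X (inf_comp V W X f' f) (inf_comp V W X g' g)"
      by (rule homotopy_hcomp_in_homotopies[OF \<theta>_homotopy \<tau>_homotopy])
    {
      assume h: "h \<in> inf_morphisms R V W" and h': "h' \<in> inf_morphisms R W X"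
        and \<theta>': "\<theta>' \<in> homotopies R V W g h" and \<tau>': "\<tau>' \<in> homotopies R W X g' h'"
      show "homotopy_hcomp V X h' f (homotopy_vcomp W X \<tau>' \<tau>) (homotopy_vcomp V W \<theta>' \<theta>)
          = homotopy_vcomp V X (homotopy_hcomp V X h' g \<tau>' \<theta>') (homotopy_hcomp V X g' f \<tau> \<theta>)"
        by (rule homotopy_interchange[OF \<theta>_homotopy homotopyI[OF V W g V W h \<theta>']
              \<tau>_homotopy homotopyI[OF W X g' W X h' \<tau>']])
    }
    assume Y: "Y \<in> leibniz2_algebras R" and f'': "f'' \<in> inf_morphisms R X Y"
      and g'': "g'' \<in> inf_morphisms R X Y" and \<sigma>: "\<sigma> \<in> homotopies R X Y f'' g''"
    show "homotopy_hcomp V Y (inf_comp W X Y g'' g') f (homotopy_hcomp W Y g'' f' \<sigma> \<tau>) \<theta>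
        = homotopy_hcomp V Y g'' (inf_comp V W X f' f) \<sigma> (homotopy_hcomp V X g' f \<tau> \<theta>)"
      by (rule homotopy_hcomp_assoc[OF \<theta>_homotopy \<tau>_homotopy homotopyI[OF X Y f'' X Y g'' \<sigma>]])
  qed
qed

end
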